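(* Let $R$ be a ring, $\sigma$ an automorphism of $R$, $\delta$ a locally nilpotent $\sigma$-derivation of $R$, and let $A=R(x;\sigma,\delta)$ be the skew Ore polynomial ring. Let $M_R$ be a right $R$-module. If $M_R$ is completely $(\sigma,\delta)$-compatible, then $$\mathrm{Att}(M[x^{-1}]_A)\supseteq\{PA \mid P\in \mathrm{Att}(M_R)\}.$$
   Context: Rings are associative with identity, not necessarily commutative; modules are right modules; $\mathbb{N}$ includes $0$. A $\sigma$-derivation of $R$ is an additive map $\delta:R\to R$ with $\delta(rs)=\sigma(r)\delta(s)+\delta(r)s$ for all $r,s\in R$. It is locally nilpotent if for every $r\in R$ there is $n(r)\ge 1$ with $\delta^{n(r)}(r)=0$. Skew Ore polynomial ring: $A=R(x;\sigma,\delta)$ is the (associative) ring containing $R$ and generated by $R$ and $x$, whose elements are uniquely representable as $r_0+r_1x+\cdots+r_kx^k$ with $r_i\in R$, $k\in\mathbb{N}$, with commutation rule $xr=\sigma(r)x+x\delta(r)x$ for all $r\in R$; equivalently $xr=\sigma(r)x+\sigma\delta(r)x^2+\cdots+\sigma\delta^{n(r)-1}(r)x^{n(r)}$ where $\delta^{n(r)}(r)=0$. It is understood as part of the definition that these data do define such a ring. Compatibility: a right module $L_R$ is $\sigma$-compatible if for all $m\in L$, $r\in R$: $mr=0$ if and only if $m\sigma(r)=0$; it is $\delta$-compatible if $mr=0$ implies $m\delta(r)=0$. $L_R$ is completely $\sigma$-compatible (resp. completely $\delta$-compatible) if $(L/N)_R$ is $\sigma$-compatible (resp. $\delta$-compatible)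 for every submodule $N_R$ of $L_R$; it is completely $(\sigma,\delta)$-compatible if it is both. Inverse polynomial module: put $\sigma'=\sigma^{-1}$ and $\delta'=-\delta\sigma^{-1}$. For $0\le i\le j$ let $f_j^i:R\to R$ be the additive map that is the sum of all possible words (compositions) in $\sigma',\delta'$ with $i$ letters $\sigma'$ and $j-i$ letters $\delta'$ ($f_0^0$ is the identity). $M[x^{-1}]$ is the additive group of all polynomials $m_0+m_1x^{-1}+\cdots+m_kx^{-k}$ with $m_i\in M$, with $R$ acting by $mx^{-k}r=\sum_{i=0}^k mf_k^i(r)x^{-i}$ (so $mx^{-1}r=m\sigma'(r)x^{-1}+m\delta'(r)$). It is a right $A$-module via this action and $x^{-i}x^j=x^{-i+j}$ if $j\le i$, and $0$ otherwise; that is, $mx^{-k}(rx^j)=\sum_{i=j}^{k}mf_k^i(r)x^{-i+j}$ (zero if $j>k$). Attached primes: for a ring $B$, a right $B$-module $N_B$ is coprime if $N\ne 0$ and $\mathrm{ann}_B(N)=\mathrm{ann}_B(Q)$ for every nonzero quotient module $Q_B$ of $N_B$, where $\mathrm{ann}_B(N)=\{b\in B\mid Nb=0\}$. A right prime ideal $P$ of $B$ is attached to a right module $L_B$ if there is a coprime quotient module $Q_B$ of $L_B$ with $P=\mathrm{ann}_B(Q)$ (being an annihilator of a module, such a $P$ is a two-sided ideal, so this means a prime ideal). $\mathrm{Att}(L_B)$ is the set of attached prime ideals of $L_B$. For an ideal $P$ of $R$, $PA$ is the right ideal of $A$ generated by $P$. *)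

theory Defs
  imports "HOL-Algebra.Ideal_Product" "HOL-Algebra.QuotRing" "HOL-Algebra.UnivPoly"
begin

section \<open>Right modules over a not necessarily commutative ring\<close>

text \<open>As in \<^theory>\<open>HOL-Algebra.Module\<close>, the record extends the ring record, but only its additive
  part is used; the multiplicative fields are irrelevant.\<close>

record ('a, 'm) rmodule = "'m ring" +
  rsmult :: "['m, 'a] \<Rightarrow> 'm" (infixl "\<bullet>\<index>" 70)

locale right_module = R?: ring R + L?: abelian_group L
  for R (structure) and L :: "('a, 'm, 'c) rmodule_scheme" (structure) +
  assumes rsmult_closed: "\<lbrakk>m \<in> carrier L; r \<in> carrier R\<rbrakk> \<Longrightarrow> m \<bullet>\<^bsub>L\<^esub> r \<in> carrier L"
    and rsmult_l_distr: "\<lbrakk>m \<in> carrier L; n \<in> carrier L; r \<in> carrier R\<rbrakk>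
          \<Longrightarrow> (m \<oplus>\<^bsub>L\<^esub> n) \<bullet>\<^bsub>L\<^esub> r = m \<bullet>\<^bsub>L\<^esub> r \<oplus>\<^bsub>L\<^esub> n \<bullet>\<^bsub>L\<^esub> r"
    and rsmult_r_distr: "\<lbrakk>m \<in> carrier L; r \<in> carrier R; s \<in> carrier R\<rbrakk>
          \<Longrightarrow> m \<bullet>\<^bsub>L\<^esub> (r \<oplus>\<^bsub>R\<^esub> s) = m \<bullet>\<^bsub>L\<^esub> r \<oplus>\<^bsub>L\<^esub> m \<bullet>\<^bsub>L\<^esub> s"
    and rsmult_assoc: "\<lbrakk>m \<in> carrier L; r \<in> carrier R; s \<in> carrier R\<rbrakk>
          \<Longrightarrow> m \<bullet>\<^bsub>L\<^esub> (r \<otimes>\<^bsub>R\<^esub> s) = (m \<bullet>\<^bsub>L\<^esub> r) \<bullet>\<^bsub>L\<^esub> s"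
    and rsmult_one: "m \<in> carrier L \<Longrightarrow> m \<bullet>\<^bsub>L\<^esub> \<one>\<^bsub>R\<^esub> = m"

definition rsubmodule :: "('a, 'b) ring_scheme \<Rightarrow> ('a, 'm, 'c) rmodule_scheme \<Rightarrow> 'm set \<Rightarrow> bool"
  where "rsubmodule R L N \<longleftrightarrow>
    additive_subgroup N L \<and> (\<forall>n\<in>N. \<forall>r\<in>carrier R. n \<bullet>\<^bsub>L\<^esub> r \<in> N)"

text \<open>The coset \<open>X\<close> times \<open>r\<close> is the coset of \<open>m \<bullet> r\<close> for any representative \<open>m \<in> X\<close>.\<close>

definition rquotient :: "('a, 'm, 'c) rmodule_scheme \<Rightarrow> 'm set \<Rightarrow> ('a, 'm set) rmodule"
  where "rquotient L N =
    \<lparr>carrier = a_rcosets\<^bsub>L\<^esub> N, mult = undefined, one = undefined, zero = N, add = set_add L,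
     rsmult = (\<lambda>X r. \<Union>m\<in>X. N +>\<^bsub>L\<^esub> (m \<bullet>\<^bsub>L\<^esub> r))\<rparr>"

definition rannihilator :: "('a, 'b) ring_scheme \<Rightarrow> ('a, 'm, 'c) rmodule_scheme \<Rightarrow> 'a set"
  where "rannihilator B N = {b \<in> carrier B. \<forall>n\<in>carrier N. n \<bullet>\<^bsub>N\<^esub> b = \<zero>\<^bsub>N\<^esub>}"


section \<open>Attached primes\<close>

definition coprime_module :: "('a, 'b) ring_scheme \<Rightarrow> ('a, 'm, 'c) rmodule_scheme \<Rightarrow> bool"
  where "coprime_module B N \<longleftrightarrow>
    carrier N \<noteq> {\<zero>\<^bsub>N\<^esub>} \<and>
    (\<forall>K. rsubmodule B N K \<and> carrier (rquotient N K) \<noteq> {\<zero>\<^bsub>rquotient N K\<^esub>} \<longrightarrow>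
         rannihilator B N = rannihilator B (rquotient N K))"

text \<open>Primeness in the sense of products of two-sided ideals; the library's \<^locale>\<open>primeideal\<close> is
  restricted to commutative rings.\<close>

definition nc_prime_ideal :: "('a, 'b) ring_scheme \<Rightarrow> 'a set \<Rightarrow> bool"
  where "nc_prime_ideal B P \<longleftrightarrow>
    ideal P B \<and> P \<noteq> carrier B \<and>
    (\<forall>I J. ideal I B \<and> ideal J B \<and> ideal_prod B I J \<subseteq> P \<longrightarrow> I \<subseteq> P \<or> J \<subseteq> P)"

definition Att :: "('a, 'b) ring_scheme \<Rightarrow> ('a, 'm, 'c) rmodule_scheme \<Rightarrow> 'a set set"
  where "Att B L = {P. nc_prime_ideal B P \<and>
    (\<exists>K. rsubmodule B L K \<and> coprime_module B (rquotient L K) \<and> P = rannihilator B (rquotient L K))}"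

definition right_ideal :: "('a, 'b) ring_scheme \<Rightarrow> 'a set \<Rightarrow> bool"
  where "right_ideal B I \<longleftrightarrow>
    additive_subgroup I B \<and> (\<forall>a\<in>I. \<forall>b\<in>carrier B. a \<otimes>\<^bsub>B\<^esub> b \<in> I)"

definition right_ideal_generated :: "('a, 'b) ring_scheme \<Rightarrow> 'a set \<Rightarrow> 'a set"
  where "right_ideal_generated B S = \<Inter>{I. right_ideal B I \<and> S \<subseteq> I}"


section \<open>Skew derivations and compatible modules\<close>

definition skew_derivation :: "('a, 'b) ring_scheme \<Rightarrow> ('a \<Rightarrow> 'a) \<Rightarrow> ('a \<Rightarrow> 'a) \<Rightarrow> bool"
  where "skew_derivation R \<sigma> \<delta> \<longleftrightarrow>
    \<delta> \<in> carrier R \<rightarrow> carrier R \<and>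
    (\<forall>r\<in>carrier R. \<forall>s\<in>carrier R. \<delta> (r \<oplus>\<^bsub>R\<^esub> s) = \<delta> r \<oplus>\<^bsub>R\<^esub> \<delta> s) \<and>
    (\<forall>r\<in>carrier R. \<forall>s\<in>carrier R. \<delta> (r \<otimes>\<^bsub>R\<^esub> s) = \<sigma> r \<otimes>\<^bsub>R\<^esub> \<delta> s \<oplus>\<^bsub>R\<^esub> \<delta> r \<otimes>\<^bsub>R\<^esub> s)"

definition locally_nilpotent :: "('a, 'b) ring_scheme \<Rightarrow> ('a \<Rightarrow> 'a) \<Rightarrow> bool"
  where "locally_nilpotent R \<delta> \<longleftrightarrow> (\<forall>r\<in>carrier R. \<exists>n\<ge>1. (\<delta> ^^ n) r = \<zero>\<^bsub>R\<^esub>)"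

definition sigma_compatible ::
    "('a, 'b) ring_scheme \<Rightarrow> ('a, 'm, 'c) rmodule_scheme \<Rightarrow> ('a \<Rightarrow> 'a) \<Rightarrow> bool"
  where "sigma_compatible R L \<sigma> \<longleftrightarrow>
    (\<forall>m\<in>carrier L. \<forall>r\<in>carrier R. m \<bullet>\<^bsub>L\<^esub> r = \<zero>\<^bsub>L\<^esub> \<longleftrightarrow> m \<bullet>\<^bsub>L\<^esub> \<sigma> r = \<zero>\<^bsub>L\<^esub>)"

definition delta_compatible ::
    "('a, 'b) ring_scheme \<Rightarrow> ('a, 'm, 'c) rmodule_scheme \<Rightarrow> ('a \<Rightarrow> 'a) \<Rightarrow> bool"
  where "delta_compatible R L \<delta> \<longleftrightarrow>
    (\<forall>m\<in>carrier L. \<forall>r\<in>carrier R. m \<bullet>\<^bsub>L\<^esub> r = \<zero>\<^bsub>L\<^esub> \<longrightarrow> m \<bullet>\<^bsub>L\<^esub> \<delta> r = \<zero>\<^bsub>L\<^esub>)"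

definition completely_sigma_compatible ::
    "('a, 'b) ring_scheme \<Rightarrow> ('a, 'm, 'c) rmodule_scheme \<Rightarrow> ('a \<Rightarrow> 'a) \<Rightarrow> bool"
  where "completely_sigma_compatible R L \<sigma> \<longleftrightarrow>
    (\<forall>N. rsubmodule R L N \<longrightarrow> sigma_compatible R (rquotient L N) \<sigma>)"

definition completely_delta_compatible ::
    "('a, 'b) ring_scheme \<Rightarrow> ('a, 'm, 'c) rmodule_scheme \<Rightarrow> ('a \<Rightarrow> 'a) \<Rightarrow> bool"
  where "completely_delta_compatible R L \<delta> \<longleftrightarrow>
    (\<forall>N. rsubmodule R L N \<longrightarrow> delta_compatible R (rquotient L N) \<delta>)"

definition completely_compatible ::
    "('a, 'b) ring_scheme \<Rightarrow> ('a, 'm, 'c) rmodule_scheme \<Rightarrow> ('a \<Rightarrow> 'a) \<Rightarrow> ('a \<Rightarrow> 'a) \<Rightarrow> bool"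
  where "completely_compatible R L \<sigma> \<delta> \<longleftrightarrow>
    completely_sigma_compatible R L \<sigma> \<and> completely_delta_compatible R L \<delta>"


section \<open>Skew Ore polynomial rings\<close>

text \<open>The inclusion of \<open>R\<close> in \<open>A\<close> is a ring homomorphism \<open>\<iota>\<close>, which is injective by the uniqueness of
  the representation. A finite coefficient sequence \<open>r\<^sub>0, r\<^sub>1, \<dots>\<close> is an element of \<^term>\<open>up R\<close>, that is,
  a function on the natural numbers that vanishes from some point on.\<close>

definition skew_ore_sum ::
    "('r, 'b) ring_scheme \<Rightarrow> ('a, 'c) ring_scheme \<Rightarrow> ('r \<Rightarrow> 'a) \<Rightarrow> 'a \<Rightarrow> (nat \<Rightarrow> 'r) \<Rightarrow> 'a"
  where "skew_ore_sum R A \<iota> x p =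
    (\<Oplus>\<^bsub>A\<^esub>i\<in>{i. p i \<noteq> \<zero>\<^bsub>R\<^esub>}. \<iota> (p i) \<otimes>\<^bsub>A\<^esub> x [^]\<^bsub>A\<^esub> i)"

text \<open>The locale says that \<open>A\<close>, with \<open>\<iota>\<close> and \<open>x\<close>, is the ring \<open>R(x; \<sigma>, \<delta>)\<close>. Not every triple
  \<open>(R, \<sigma>, \<delta>)\<close> admits such an associative ring, so the existence of \<open>A\<close> is part of the data.\<close>

locale skew_ore_ring = R?: ring R + A?: ring A
  for R :: "('r, 'b) ring_scheme" (structure) and A :: "('a, 'c) ring_scheme" (structure) +
  fixes \<sigma> \<delta> :: "'r \<Rightarrow> 'r" and \<iota> :: "'r \<Rightarrow> 'a" and x :: 'a
  assumes embedding: "\<iota> \<in> ring_hom R A"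
    and x_closed: "x \<in> carrier A"
    and unique_representation:
      "a \<in> carrier A \<Longrightarrow> \<exists>!p. p \<in> up R \<and> a = skew_ore_sum R A \<iota> x p"
    and commutation: "r \<in> carrier R \<Longrightarrow>
      x \<otimes>\<^bsub>A\<^esub> \<iota> r = \<iota> (\<sigma> r) \<otimes>\<^bsub>A\<^esub> x \<oplus>\<^bsub>A\<^esub> x \<otimes>\<^bsub>A\<^esub> \<iota> (\<delta> r) \<otimes>\<^bsub>A\<^esub> x"

definition skew_ore_coeff ::
    "('r, 'b) ring_scheme \<Rightarrow> ('a, 'c) ring_scheme \<Rightarrow> ('r \<Rightarrow> 'a) \<Rightarrow> 'a \<Rightarrow> 'a \<Rightarrow> nat \<Rightarrow> 'r"
  where "skew_ore_coeff R A \<iota> x a = (THE p. p \<in> up R \<and> a = skew_ore_sum R A \<iota> x p)"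


section \<open>The inverse polynomial module\<close>

definition sigma' :: "('r, 'b) ring_scheme \<Rightarrow> ('r \<Rightarrow> 'r) \<Rightarrow> 'r \<Rightarrow> 'r"
  where "sigma' R \<sigma> = inv_into (carrier R) \<sigma>"

definition delta' :: "('r, 'b) ring_scheme \<Rightarrow> ('r \<Rightarrow> 'r) \<Rightarrow> ('r \<Rightarrow> 'r) \<Rightarrow> 'r \<Rightarrow> 'r"
  where "delta' R \<sigma> \<delta> r = \<ominus>\<^bsub>R\<^esub> \<delta> (sigma' R \<sigma> r)"

text \<open>Words in \<open>\<sigma>'\<close> and \<open>\<delta>'\<close> are encoded as lists of Booleans, with \<^term>\<open>True\<close> for the letter \<open>\<sigma>'\<close>
  and \<^term>\<open>False\<close> for \<open>\<delta>'\<close>. \<open>skew_word_sum R \<sigma> \<delta> j i\<close> is the map \<open>f\<close> with lower index \<open>j\<close> (the length)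
  and upper index \<open>i\<close> (the number of letters \<open>\<sigma>'\<close>).\<close>

definition skew_word ::
    "('r, 'b) ring_scheme \<Rightarrow> ('r \<Rightarrow> 'r) \<Rightarrow> ('r \<Rightarrow> 'r) \<Rightarrow> bool list \<Rightarrow> 'r \<Rightarrow> 'r"
  where "skew_word R \<sigma> \<delta> w = foldr (\<lambda>b. if b then sigma' R \<sigma> else delta' R \<sigma> \<delta>) w"

definition skew_word_sum ::
    "('r, 'b) ring_scheme \<Rightarrow> ('r \<Rightarrow> 'r) \<Rightarrow> ('r \<Rightarrow> 'r) \<Rightarrow> nat \<Rightarrow> nat \<Rightarrow> 'r \<Rightarrow> 'r"
  where "skew_word_sum R \<sigma> \<delta> j i r =
    (\<Oplus>\<^bsub>R\<^esub>w\<in>{w. length w = j \<and> count_list w True = i}. skew_word R \<sigma> \<delta> w r)"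

text \<open>An element of \<^term>\<open>up M\<close> stands for \<open>m\<^sub>0 + m\<^sub>1 x\<inverse> + m\<^sub>2 x\<^sup>-\<^sup>2 + \<dots>\<close>: the index is the negated
  exponent. The action of \<open>R\<close> extends \<open>m x\<^sup>-\<^sup>k r = (\<Sum>i=0..k. m f\<^sub>k\<^sup>i(r) x\<^sup>-\<^sup>i)\<close> additively.\<close>

definition inv_poly_scale ::
    "('r, 'b) ring_scheme \<Rightarrow> ('r \<Rightarrow> 'r) \<Rightarrow> ('r \<Rightarrow> 'r) \<Rightarrow> ('r, 'm, 'c) rmodule_scheme
      \<Rightarrow> (nat \<Rightarrow> 'm) \<Rightarrow> 'r \<Rightarrow> (nat \<Rightarrow> 'm)"
  where "inv_poly_scale R \<sigma> \<delta> M p r =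
    (\<lambda>i. \<Oplus>\<^bsub>M\<^esub>k\<in>{k. p k \<noteq> \<zero>\<^bsub>M\<^esub> \<and> i \<le> k}. p k \<bullet>\<^bsub>M\<^esub> skew_word_sum R \<sigma> \<delta> k i r)"

text \<open>Multiplication by \<open>x\<^sup>j\<close> sends \<open>m x\<^sup>-\<^sup>i\<close> to \<open>m x\<^bsup>-i+j\<^esup>\<close>, or to \<open>0\<close> if \<open>j > i\<close>, so it shifts the
  coefficients down by \<open>j\<close> places.\<close>

definition inv_poly_shift :: "nat \<Rightarrow> (nat \<Rightarrow> 'm) \<Rightarrow> (nat \<Rightarrow> 'm)"
  where "inv_poly_shift j p = (\<lambda>l. p (l + j))"

definition inv_poly_module ::
    "('r, 'b) ring_scheme \<Rightarrow> ('a, 'd) ring_scheme \<Rightarrow> ('r \<Rightarrow> 'r) \<Rightarrow> ('r \<Rightarrow> 'r) \<Rightarrow> ('r \<Rightarrow> 'a) \<Rightarrow> 'a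
      \<Rightarrow> ('r, 'm, 'c) rmodule_scheme \<Rightarrow> ('a, nat \<Rightarrow> 'm) rmodule"
  where "inv_poly_module R A \<sigma> \<delta> \<iota> x M =
    \<lparr>carrier = up M, mult = undefined, one = undefined,
     zero = (\<lambda>i. \<zero>\<^bsub>M\<^esub>), add = (\<lambda>p q i. p i \<oplus>\<^bsub>M\<^esub> q i),
     rsmult = (\<lambda>p a l. \<Oplus>\<^bsub>M\<^esub>j\<in>{j. skew_ore_coeff R A \<iota> x a j \<noteq> \<zero>\<^bsub>R\<^esub>}.
       inv_poly_shift j (inv_poly_scale R \<sigma> \<delta> M p (skew_ore_coeff R A \<iota> x a j)) l)\<rparr>"

end

theory Submission
  imports Defs
begin

text \<open>Let \<open>P = ann(M/N)\<close> with \<open>M/N\<close> coprime. By compatibility \<open>P\<close> is stable under \<open>\<sigma>\<close>, \<open>\<sigma>\<inverse>\<close> and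
  \<open>\<delta>\<close>, so \<open>PA\<close> consists of the elements of \<open>A\<close> with all coefficients in \<open>P\<close>; it is two-sided because
  \<open>\<delta>\<close> is locally nilpotent, and prime by comparing lowest coefficients outside \<open>P\<close>. The coprime
  quotient is that by \<open>N[x\<inverse>]\<close>. If \<open>K\<close> is a proper submodule containing \<open>N[x\<inverse>]\<close>, then for
  some \<open>n\<close> the leading coefficients at \<open>x\<^sup>-\<^sup>n\<close> of elements of \<open>K\<close> form a proper submodule of \<open>M\<close> containing
  \<open>N\<close>, whose quotient again has annihilator \<open>P\<close>. If \<open>a\<close> maps everything into \<open>K\<close> and its coefficients
  below \<open>j\<close> lie in \<open>P\<close>, then the leading term of \<open>m x\<^bsup>-n-j\<^esup> a\<close> modulo \<open>N\<close> is
  \<open>m \<sigma>\<^bsup>-n-j\<^esup>(a\<^sub>j) x\<^sup>-\<^sup>n\<close>, which forces \<open>a\<^sub>j \<in> P\<close>.\<close>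

section \<open>Quotients of additive right actions\<close>

text \<open>Leaving out associativity and unitality avoids a proof that the inverse polynomials form a
  module over \<open>A\<close>.\<close>

locale right_action = L?: abelian_group L
  for B :: "('a, 'b) ring_scheme" and L :: "('a, 'm, 'c) rmodule_scheme" (structure) +
  assumes act_closed: "\<lbrakk>m \<in> carrier L; b \<in> carrier B\<rbrakk> \<Longrightarrow> m \<bullet>\<^bsub>L\<^esub> b \<in> carrier L"
    and act_l_distr: "\<lbrakk>m \<in> carrier L; n \<in> carrier L; b \<in> carrier B\<rbrakk>
          \<Longrightarrow> (m \<oplus>\<^bsub>L\<^esub> n) \<bullet>\<^bsub>L\<^esub> b = m \<bullet>\<^bsub>L\<^esub> b \<oplus>\<^bsub>L\<^esub> n \<bullet>\<^bsub>L\<^esub> b"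
begin

lemma act_zero: "b \<in> carrier B \<Longrightarrow> \<zero> \<bullet> b = \<zero>"
  using act_l_distr[of \<zero> \<zero> b] act_closed[of \<zero> b] by simp

lemma act_minus:
  assumes "m \<in> carrier L" "b \<in> carrier B"
  shows "(\<ominus> m) \<bullet> b = \<ominus> (m \<bullet> b)"
proof -
  have "(\<ominus> m) \<bullet> b \<oplus> m \<bullet> b = \<zero>"
    using assms act_l_distr[of "\<ominus> m" m b] act_zero by (simp add: L.l_neg)
  then show ?thesis
    using assms act_closed by (metis L.a_inv_closed L.minus_equality)
qed

end

lemma right_module_imp_right_action: "right_module R M \<Longrightarrow> right_action R M"
  by (simp add: right_action_def right_action_axioms_def right_module_def right_module_axioms_def)

section \<open>Cosets of additive subgroups\<close>

lemma (in abelian_group) additive_subgroup_minus: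
  assumes "additive_subgroup N G" "m \<in> N" "n \<in> N"
  shows "m \<ominus> n \<in> N"
  using assms by (simp add: a_minus_def additive_subgroup.a_closed additive_subgroup.a_inv_closed
      abelian_group_axioms)

lemma (in abelian_group) additive_subgroup_add_cancel:
  assumes "additive_subgroup N G" "m \<in> carrier G" "n \<in> N"
  shows "m \<oplus> n \<in> N \<longleftrightarrow> m \<in> N"
proof
  assume "m \<oplus> n \<in> N"
  then have "(m \<oplus> n) \<ominus> n \<in> N" using assms additive_subgroup_minus by blast
  moreover have "(m \<oplus> n) \<ominus> n = m"
    using assms additive_subgroup.a_Hcarr[OF assms(1)]
    by (simp add: a_minus_def a_assoc r_neg)
  ultimately show "m \<in> N" by simp
next
  assume "m \<in> N"
  then show "m \<oplus> n \<in> N" using assms(3) by (rule additive_subgroup.a_closed[OF assms(1)])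
qed

lemma (in abelian_group) a_coset_eq_iff:
  assumes "additive_subgroup N G" "m \<in> carrier G" "n \<in> carrier G"
  shows "N +> m = N +> n \<longleftrightarrow> m \<ominus> n \<in> N"
proof -
  interpret N: abelian_subgroup N G
    using assms(1) abelian_group_axioms by (rule abelian_subgroupI3)
  show ?thesis
    using assms by (metis N.a_rcos_module N.a_rcos_self N.a_repr_independence' a_minus_def)
qed

lemma (in abelian_group) a_coset_eq_self_iff:
  assumes "additive_subgroup N G" "m \<in> carrier G"
  shows "N +> m = N \<longleftrightarrow> m \<in> N"
proof -
  interpret N: abelian_subgroup N G
    using assms(1) abelian_group_axioms by (rule abelian_subgroupI3)
  show ?thesis
    using assms N.a_rcos_const N.a_rcos_self by metis
qed

section \<open>The quotient by a submodule and the submodules of that quotient\<close>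

locale right_action_sub = right_action +
  fixes N
  assumes rsub: "rsubmodule B L N"
begin

lemma add_sub: "additive_subgroup N L"
  using rsub by (simp add: rsubmodule_def)

lemma sub_act_closed: "\<lbrakk>n \<in> N; b \<in> carrier B\<rbrakk> \<Longrightarrow> n \<bullet> b \<in> N"
  using rsub by (simp add: rsubmodule_def)

lemma sub_carrier: "n \<in> N \<Longrightarrow> n \<in> carrier L"
  by (rule additive_subgroup.a_Hcarr[OF add_sub])

sublocale N: abelian_subgroup N L
  using add_sub L.abelian_group_axioms by (rule abelian_subgroupI3)

lemma rquotient_carrier: "carrier (rquotient L N) = (\<lambda>m. N +> m) ` carrier L"
  by (auto simp: rquotient_def A_RCOSETS_def')

lemma rquotient_zero: "\<zero>\<^bsub>rquotient L N\<^esub> = N"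
  by (simp add: rquotient_def)

lemma rquotient_add:
  "\<lbrakk>m \<in> carrier L; n \<in> carrier L\<rbrakk> \<Longrightarrow>
    (N +> m) \<oplus>\<^bsub>rquotient L N\<^esub> (N +> n) = N +> (m \<oplus> n)"
  by (simp add: rquotient_def N.a_rcos_sum)

text \<open>Two representatives of a coset differ by an element of \<open>N\<close>, which the
  action keeps in \<open>N\<close>, so the union in \<open>rquotient\<close> runs over equal sets.
  It collapses to one of them because a coset is never empty.\<close>

lemma rquotient_act:
  assumes "m \<in> carrier L" "b \<in> carrier B"
  shows "(N +> m) \<bullet>\<^bsub>rquotient L N\<^esub> b = N +> (m \<bullet> b)"
proof -
  have "N +> (m' \<bullet> b) = N +> (m \<bullet> b)" if m': "m' \<in> N +> m" for m'
  proof -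
    have c: "m' \<in> carrier L" using m' assms N.a_elemrcos_carrier by blast
    have "m' \<ominus> m \<in> N"
      using N.a_rcos_module_imp[OF assms(1) m'] by (simp add: a_minus_def)
    then have "(m' \<ominus> m) \<bullet> b \<in> N" using assms sub_act_closed by blast
    then have "m' \<bullet> b \<ominus> m \<bullet> b \<in> N"
      using assms c by (simp add: a_minus_def act_l_distr act_minus)
    then show ?thesis using assms c by (simp add: act_closed a_coset_eq_iff[OF add_sub])
  qed
  then have "(\<Union>m'\<in>N +> m. N +> (m' \<bullet> b)) = (\<Union>m'\<in>N +> m. N +> (m \<bullet> b))"
    by (rule SUP_cong[OF refl])
  also have "\<dots> = N +> (m \<bullet> b)"
    using N.a_rcos_self[OF assms(1)] by (simp only: UN_constant) auto
  finally show ?thesis by (simp add: rquotient_def)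
qed

lemma abelian_group_rquotient: "abelian_group (rquotient L N)"
proof (rule abelian_groupI; unfold rquotient_carrier)
  show "\<zero>\<^bsub>rquotient L N\<^esub> \<in> (+>) N ` carrier L"
    using a_coset_eq_self_iff[OF add_sub L.zero_closed] N.zero_closed L.zero_closed
    by (metis image_eqI rquotient_zero)
next
  fix X assume "X \<in> (+>) N ` carrier L"
  then obtain m where m: "m \<in> carrier L" "X = N +> m" by blast
  have z: "\<zero>\<^bsub>rquotient L N\<^esub> = N +> \<zero>"
    using a_coset_eq_self_iff[OF add_sub L.zero_closed] N.zero_closed by (simp add: rquotient_zero)
  show "\<zero>\<^bsub>rquotient L N\<^esub> \<oplus>\<^bsub>rquotient L N\<^esub> X = X"
    using m unfolding z m(2) by (simp only: rquotient_add L.zero_closed L.l_zero)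
  have "(N +> \<ominus> m) \<oplus>\<^bsub>rquotient L N\<^esub> X = \<zero>\<^bsub>rquotient L N\<^esub>"
    using m unfolding z m(2) by (simp only: rquotient_add L.a_inv_closed L.l_neg)
  then show "\<exists>Y\<in>(+>) N ` carrier L. Y \<oplus>\<^bsub>rquotient L N\<^esub> X = \<zero>\<^bsub>rquotient L N\<^esub>"
    using m by blast
qed (auto simp: rquotient_add L.a_ac)

lemma right_action_rquotient: "right_action B (rquotient L N)"
proof -
  interpret Q: abelian_group "rquotient L N" by (rule abelian_group_rquotient)
  show ?thesis
    by unfold_locales
      (auto simp: rquotient_carrier rquotient_act act_closed rquotient_add act_l_distr)
qed

lemma rannihilator_rquotient:
  "rannihilator B (rquotient L N) = {b \<in> carrier B. \<forall>m\<in>carrier L. m \<bullet> b \<in> N}"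
proof -
  have "(N +> m) \<bullet>\<^bsub>rquotient L N\<^esub> b = N \<longleftrightarrow> m \<bullet> b \<in> N"
    if "m \<in> carrier L" "b \<in> carrier B" for m b
    using that by (simp add: rquotient_act act_closed a_coset_eq_self_iff[OF add_sub])
  then show ?thesis
    by (simp add: rannihilator_def rquotient_carrier rquotient_zero cong: conj_cong)
qed

lemma rquotient_nonzero:
  "carrier (rquotient L N) \<noteq> {\<zero>\<^bsub>rquotient L N\<^esub>} \<longleftrightarrow> N \<noteq> carrier L"
proof -
  have "carrier (rquotient L N) = {\<zero>\<^bsub>rquotient L N\<^esub>} \<longleftrightarrow> (\<forall>m\<in>carrier L. N +> m = N)"
    unfolding rquotient_carrier rquotient_zero
    using L.add.carrier_not_empty subset_singleton_iff[of "(+>) N ` carrier L" N]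
    by (simp add: image_subset_iff)
  also have "\<dots> \<longleftrightarrow> carrier L \<subseteq> N"
    by (simp add: a_coset_eq_self_iff[OF add_sub] subset_iff Ball_def)
  finally show ?thesis using N.a_subset by blast
qed

text \<open>With \<open>rsubmodule_image\<close> and \<open>coset_mem_image_iff\<close> this is the
  correspondence between submodules of the quotient and submodules of \<open>L\<close> above
  \<open>N\<close>.\<close>

lemma rsubmodule_preimage:
  assumes "rsubmodule B (rquotient L N) K"
  shows "rsubmodule B L {m \<in> carrier L. N +> m \<in> K}"
proof -
  interpret Q: abelian_group "rquotient L N" by (rule abelian_group_rquotient)
  have K: "additive_subgroup K (rquotient L N)"
    using assms by (simp add: rsubmodule_def)
  have "subgroup {m \<in> carrier L. N +> m \<in> K} (add_monoid L)"
  proof (rule L.add.subgroupI)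
    have "N \<in> K" using additive_subgroup.zero_closed[OF K] by (simp add: rquotient_zero)
    then show "{m \<in> carrier L. N +> m \<in> K} \<noteq> {}"
      using a_coset_eq_self_iff[OF add_sub L.zero_closed] N.zero_closed by force
  next
    fix m assume m: "m \<in> {m \<in> carrier L. N +> m \<in> K}"
    \<comment> \<open>The record of the quotient has no field for negation, so the inverse of a
      coset is identified through uniqueness of additive inverses.\<close>
    have "(N +> \<ominus> m) \<oplus>\<^bsub>rquotient L N\<^esub> (N +> m) = \<zero>\<^bsub>rquotient L N\<^esub>"
      using m a_coset_eq_self_iff[OF add_sub L.zero_closed]
      by (simp add: rquotient_add rquotient_zero L.l_neg)
    moreover have "N +> m \<in> carrier (rquotient L N)" "N +> (\<ominus> m) \<in> carrier (rquotient L N)"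
      using m by (auto simp: rquotient_carrier)
    ultimately have "N +> (\<ominus> m) = \<ominus>\<^bsub>rquotient L N\<^esub> (N +> m)"
      using Q.minus_equality by simp
    then show "\<ominus> m \<in> {m \<in> carrier L. N +> m \<in> K}"
      using m additive_subgroup.a_inv_closed[OF K] by auto
  next
    fix m n assume m: "m \<in> {m \<in> carrier L. N +> m \<in> K}" and n: "n \<in> {m \<in> carrier L. N +> m \<in> K}"
    then have "(N +> m) \<oplus>\<^bsub>rquotient L N\<^esub> (N +> n) \<in> K"
      using additive_subgroup.a_closed[OF K] by blast
    then show "m \<oplus> n \<in> {m \<in> carrier L. N +> m \<in> K}"
      using m n by (simp add: rquotient_add)
  qed auto
  moreover have "N +> (m \<bullet> b) \<in> K" if "m \<in> carrier L" "N +> m \<in> K" "b \<in> carrier B" for m b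
    using assms that rquotient_act[of m b] unfolding rsubmodule_def by metis
  ultimately show ?thesis
    by (auto simp: rsubmodule_def additive_subgroup_def act_closed)
qed

lemma rsubmodule_image:
  assumes "rsubmodule B L K"
  shows "rsubmodule B (rquotient L N) ((\<lambda>m. N +> m) ` K)"
proof -
  interpret Q: abelian_group "rquotient L N" by (rule abelian_group_rquotient)
  have K: "additive_subgroup K L"
    using assms by (simp add: rsubmodule_def)
  note Kc = additive_subgroup.a_Hcarr[OF K]
  have "subgroup ((\<lambda>m. N +> m) ` K) (add_monoid (rquotient L N))"
  proof (rule Q.add.subgroupI)
    show "(+>) N ` K \<subseteq> carrier (rquotient L N)"
      using Kc by (auto simp: rquotient_carrier)
    show "(+>) N ` K \<noteq> {}" using additive_subgroup.zero_closed[OF K] by blast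
  next
    fix X assume "X \<in> (+>) N ` K"
    then obtain m where m: "m \<in> K" "X = N +> m" by blast
    have "(N +> \<ominus> m) \<oplus>\<^bsub>rquotient L N\<^esub> (N +> m) = \<zero>\<^bsub>rquotient L N\<^esub>"
      using m Kc a_coset_eq_self_iff[OF add_sub L.zero_closed]
      by (simp add: rquotient_add rquotient_zero L.l_neg)
    moreover have "N +> m \<in> carrier (rquotient L N)" "N +> (\<ominus> m) \<in> carrier (rquotient L N)"
      using m Kc by (auto simp: rquotient_carrier)
    ultimately have "N +> (\<ominus> m) = \<ominus>\<^bsub>rquotient L N\<^esub> (N +> m)"
      using Q.minus_equality by simp
    then show "\<ominus>\<^bsub>rquotient L N\<^esub> X \<in> (+>) N ` K"
      using m additive_subgroup.a_inv_closed[OF K] by (metis image_eqI)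
  next
    fix X Y assume "X \<in> (+>) N ` K" "Y \<in> (+>) N ` K"
    then obtain m n where "m \<in> K" "n \<in> K" "X = N +> m" "Y = N +> n" by blast
    then show "X \<oplus>\<^bsub>rquotient L N\<^esub> Y \<in> (+>) N ` K"
      using Kc additive_subgroup.a_closed[OF K] by (auto simp: rquotient_add)
  qed
  moreover have "(N +> m) \<bullet>\<^bsub>rquotient L N\<^esub> b \<in> (\<lambda>m. N +> m) ` K"
    if "m \<in> K" "b \<in> carrier B" for m b
    using assms that Kc by (auto simp: rquotient_act rsubmodule_def)
  ultimately show ?thesis
    by (auto simp: rsubmodule_def additive_subgroup_def)
qed

text \<open>The coset may lie in the image through another representative; the two differ by an
  element of \<open>N\<close>, hence of \<open>K\<close>.\<close>

lemma coset_mem_image_iff: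
  assumes "rsubmodule B L K" "N \<subseteq> K" "m \<in> carrier L"
  shows "N +> m \<in> (\<lambda>m. N +> m) ` K \<longleftrightarrow> m \<in> K"
proof
  assume "N +> m \<in> (\<lambda>m. N +> m) ` K"
  then obtain k where k: "k \<in> K" "N +> m = N +> k" by blast
  have K: "additive_subgroup K L"
    using assms by (simp add: rsubmodule_def)
  have kc: "k \<in> carrier L" by (rule additive_subgroup.a_Hcarr[OF K k(1)])
  have "m \<ominus> k \<in> N" using k kc assms(3) a_coset_eq_iff[OF add_sub] by simp
  then have "m \<ominus> k \<in> K" using assms(2) by (rule rev_subsetD)
  then show "m \<in> K"
    using additive_subgroup_add_cancel[OF K, of m "\<ominus> k"] k assms(3)
      additive_subgroup.a_inv_closed[OF K] by (simp add: a_minus_def)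
qed auto

text \<open>The quotients of L/N are the L/K with \<open>K\<close> above \<open>N\<close>. Testing
  coprimality on such \<open>K\<close> keeps cosets of cosets out of everything that
  follows.\<close>

theorem coprime_rquotient_iff:
  "coprime_module B (rquotient L N) \<longleftrightarrow> N \<noteq> carrier L \<and>
    (\<forall>K. rsubmodule B L K \<and> N \<subseteq> K \<and> K \<noteq> carrier L \<longrightarrow>
      {b \<in> carrier B. \<forall>m\<in>carrier L. m \<bullet> b \<in> N} = {b \<in> carrier B. \<forall>m\<in>carrier L. m \<bullet> b \<in> K})"
    (is "?lhs \<longleftrightarrow> _ \<and> ?rhs")
proof -
  interpret Q: right_action B "rquotient L N" by (rule right_action_rquotient)
  let ?Q = "rquotient L N"
  have sub: "right_action_sub B ?Q K" if "rsubmodule B ?Q K" for K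
    using that Q.right_action_axioms by (simp add: right_action_sub_def right_action_sub_axioms_def)
  have ann: "rannihilator B (rquotient ?Q K) =
      {b \<in> carrier B. \<forall>m\<in>carrier L. N +> (m \<bullet> b) \<in> K}" if "rsubmodule B ?Q K" for K
    using right_action_sub.rannihilator_rquotient[OF sub[OF that]]
    by (auto simp: rquotient_carrier rquotient_act)
  have nz: "carrier (rquotient ?Q K) \<noteq> {\<zero>\<^bsub>rquotient ?Q K\<^esub>} \<longleftrightarrow> K \<noteq> carrier ?Q"
    if "rsubmodule B ?Q K" for K
    using right_action_sub.rquotient_nonzero[OF sub[OF that]] .
  \<comment> \<open>At this stage \<open>K\<close> still ranges over submodules of the quotient; the
    correspondence then trades them for submodules of \<open>L\<close> above
    \<open>N\<close>.\<close>
  have eq: "?lhs \<longleftrightarrow> N \<noteq> carrier L \<and> (\<forall>K. rsubmodule B ?Q K \<and> K \<noteq> carrier ?Q \<longrightarrow>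
      {b \<in> carrier B. \<forall>m\<in>carrier L. m \<bullet> b \<in> N} =
      {b \<in> carrier B. \<forall>m\<in>carrier L. N +> (m \<bullet> b) \<in> K})" (is "_ \<longleftrightarrow> _ \<and> ?mid")
    unfolding coprime_module_def rquotient_nonzero
    by (simp add: ann nz rannihilator_rquotient cong: conj_cong)
  have "?mid \<longleftrightarrow> ?rhs"
  proof
    assume mid: ?mid
    show ?rhs
    proof (intro allI impI)
      fix K assume K: "rsubmodule B L K \<and> N \<subseteq> K \<and> K \<noteq> carrier L"
      then have iff: "N +> m \<in> (\<lambda>m. N +> m) ` K \<longleftrightarrow> m \<in> K" if "m \<in> carrier L" for m
        using that coset_mem_image_iff by blast
      have "K \<subseteq> carrier L"
        using K by (meson additive_subgroup.a_subset rsubmodule_def)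
      then obtain m where "m \<in> carrier L" "m \<notin> K" using K by blast
      then have ne: "(\<lambda>m. N +> m) ` K \<noteq> carrier ?Q"
        using iff by (metis image_eqI rquotient_carrier)
      then have "{b \<in> carrier B. \<forall>m\<in>carrier L. m \<bullet> b \<in> N} =
          {b \<in> carrier B. \<forall>m\<in>carrier L. N +> (m \<bullet> b) \<in> (\<lambda>m. N +> m) ` K}"
        using mid rsubmodule_image[of K] K by (simp only:) simp
      also have "\<dots> = {b \<in> carrier B. \<forall>m\<in>carrier L. m \<bullet> b \<in> K}"
        by (simp add: iff act_closed cong: conj_cong)
      finally show "{b \<in> carrier B. \<forall>m\<in>carrier L. m \<bullet> b \<in> N} =
          {b \<in> carrier B. \<forall>m\<in>carrier L. m \<bullet> b \<in> K}" .
    qed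
  next
    assume rhs: ?rhs
    show ?mid
    proof (intro allI impI)
      fix K assume K: "rsubmodule B ?Q K \<and> K \<noteq> carrier ?Q"
      let ?K = "{m \<in> carrier L. N +> m \<in> K}"
      have KQ: "additive_subgroup K ?Q" using K by (simp add: rsubmodule_def)
      have "N \<in> K" using additive_subgroup.zero_closed[OF KQ] by (simp add: rquotient_zero)
      then have "N \<subseteq> ?K"
        using sub_carrier N.a_rcos_const by (simp add: subset_iff)
      moreover have "?K \<noteq> carrier L"
      proof
        assume "?K = carrier L"
        then have "carrier ?Q \<subseteq> K" by (auto simp: rquotient_carrier)
        then show False using K additive_subgroup.a_subset[OF KQ] by blast
      qed
      ultimately have "{b \<in> carrier B. \<forall>m\<in>carrier L. m \<bullet> b \<in> N} =
          {b \<in> carrier B. \<forall>m\<in>carrier L. m \<bullet> b \<in> ?K}"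
        using rhs K rsubmodule_preimage by blast
      then show "{b \<in> carrier B. \<forall>m\<in>carrier L. m \<bullet> b \<in> N} =
          {b \<in> carrier B. \<forall>m\<in>carrier L. N +> (m \<bullet> b) \<in> K}"
        using act_closed by blast
    qed
  qed
  with eq show ?thesis by simp
qed

end

section \<open>Coefficients in a skew Ore polynomial ring\<close>

lemma up_iff:
  "p \<in> up L \<longleftrightarrow> (\<forall>i. p i \<in> carrier L) \<and> (\<exists>n. \<forall>i>n. p i = \<zero>\<^bsub>L\<^esub>)"
  by (auto simp: up_def bound_def)

lemma upI':
  assumes "\<And>i. p i \<in> carrier L" "\<forall>i>n. p i = \<zero>\<^bsub>L\<^esub>"
  shows "p \<in> up L"
  using assms by (auto simp: up_iff)

lemma up_finite_support:
  assumes "p \<in> up L"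
  shows "finite {i. p i \<noteq> \<zero>\<^bsub>L\<^esub>}"
proof -
  obtain n where "\<forall>i>n. p i = \<zero>\<^bsub>L\<^esub>" using assms by (auto simp: up_iff)
  then have "{i. p i \<noteq> \<zero>\<^bsub>L\<^esub>} \<subseteq> {..n}" by (auto simp: not_le[symmetric])
  then show ?thesis using finite_subset by blast
qed

lemma up_mono:
  assumes "p \<in> up L" "\<And>i. q i \<in> carrier L" "\<And>i. p i = \<zero>\<^bsub>L\<^esub> \<Longrightarrow> q i = \<zero>\<^bsub>L\<^esub>"
  shows "q \<in> up L"
  using assms unfolding up_iff by metis

lemma (in abelian_monoid) up_add:
  assumes "p \<in> up G" "q \<in> up G"
  shows "(\<lambda>i. p i \<oplus> q i) \<in> up G"
proof -
  obtain m n where "\<forall>i>m. p i = \<zero>" "\<forall>i>n. q i = \<zero>" using assms by (auto simp: up_iff)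
  then have "\<forall>i>max m n. p i \<oplus> q i = \<zero>" by simp
  moreover have "p i \<oplus> q i \<in> carrier G" for i using assms by (auto simp: up_iff)
  ultimately show ?thesis by (rule upI'[rotated])
qed

lemma up_case_nat:
  assumes "p \<in> up L" "r \<in> carrier L"
  shows "case_nat r p \<in> up L"
proof -
  obtain n where "\<forall>i>n. p i = \<zero>\<^bsub>L\<^esub>" using assms by (auto simp: up_iff)
  then have "\<forall>i>Suc n. case_nat r p i = \<zero>\<^bsub>L\<^esub>" by (auto split: nat.split)
  moreover have "case_nat r p i \<in> carrier L" for i
    using assms by (auto simp: up_iff split: nat.split)
  ultimately show ?thesis by (rule upI'[rotated])
qed

lemma up_shift:
  assumes "p \<in> up L"
  shows "(\<lambda>i. p (i + n)) \<in> up L"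
  using assms by (auto simp: up_iff intro: trans_less_add1)

section \<open>Coefficient formulas and splitting off right factors x\<close>

context skew_ore_ring
begin

abbreviation coeff where "coeff \<equiv> skew_ore_coeff R A \<iota> x"

sublocale emb: ring_hom_ring R A \<iota>
  using embedding R.ring_axioms A.ring_axioms by (simp add: ring_hom_ringI2)

lemma pow_x_closed [simp]: "x [^]\<^bsub>A\<^esub> (n::nat) \<in> carrier A"
  using x_closed by simp

text \<open>The defining sum runs over the exact support, which changes with \<open>p\<close>; a
  common initial segment lets sums for different elements be compared termwise.\<close>

lemma skew_ore_sum_bound:
  assumes "p \<in> up R" "\<forall>i>n. p i = \<zero>\<^bsub>R\<^esub>"
  shows "skew_ore_sum R A \<iota> x p = (\<Oplus>\<^bsub>A\<^esub>i\<in>{..n}. \<iota> (p i) \<otimes>\<^bsub>A\<^esub> x [^]\<^bsub>A\<^esub> i)"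
  unfolding skew_ore_sum_def
proof (rule A.add.finprod_mono_neutral_cong_left)
  show "{i. p i \<noteq> \<zero>\<^bsub>R\<^esub>} \<subseteq> {..n}" using assms by (auto simp: not_le[symmetric])
qed (use assms in \<open>auto simp: up_iff\<close>)

lemma skew_ore_sum_closed:
  assumes "p \<in> up R"
  shows "skew_ore_sum R A \<iota> x p \<in> carrier A"
  unfolding skew_ore_sum_def using assms by (intro A.finsum_closed) (auto simp: up_iff)

lemma coeff_up: "a \<in> carrier A \<Longrightarrow> coeff a \<in> up R"
  and skew_ore_sum_coeff: "a \<in> carrier A \<Longrightarrow> skew_ore_sum R A \<iota> x (coeff a) = a"
  using theI'[OF unique_representation, of a] by (auto simp: skew_ore_coeff_def)

lemma coeff_closed [simp]: "a \<in> carrier A \<Longrightarrow> coeff a i \<in> carrier R"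
  using coeff_up by (simp add: up_iff)

lemma coeff_skew_ore_sum:
  assumes "p \<in> up R"
  shows "coeff (skew_ore_sum R A \<iota> x p) = p"
  using unique_representation[OF skew_ore_sum_closed[OF assms]] assms
    coeff_up[OF skew_ore_sum_closed[OF assms]] skew_ore_sum_coeff[OF skew_ore_sum_closed[OF assms]]
  by metis

lemma coeff_eqI:
  assumes "a \<in> carrier A" "b \<in> carrier A" "\<And>i. coeff a i = coeff b i"
  shows "a = b"
  using assms skew_ore_sum_coeff by (metis ext)

lemma coeff_surj:
  assumes "p \<in> up R"
  obtains a where "a \<in> carrier A" "coeff a = p"
  using assms coeff_skew_ore_sum skew_ore_sum_closed by blast

text \<open>By uniqueness of the representation it suffices to exhibit a finite sequence that
  represents the element. Here both summands are written over a common bound and added termwise; the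
  formulas for \<open>\<iota> r\<close>, for left multiples by \<open>\<iota> r\<close> and for
  right multiples by \<open>x\<close> follow the same scheme.\<close>

lemma coeff_add [simp]:
  assumes "a \<in> carrier A" "b \<in> carrier A"
  shows "coeff (a \<oplus>\<^bsub>A\<^esub> b) i = coeff a i \<oplus>\<^bsub>R\<^esub> coeff b i"
proof -
  obtain m n where mn: "\<forall>i>m. coeff a i = \<zero>\<^bsub>R\<^esub>" "\<forall>i>n. coeff b i = \<zero>\<^bsub>R\<^esub>"
    using assms[THEN coeff_up] by (auto simp: up_iff)
  let ?c = "\<lambda>i. coeff a i \<oplus>\<^bsub>R\<^esub> coeff b i"
  have c: "?c \<in> up R" using assms[THEN coeff_up] by (rule R.up_add)
  have "skew_ore_sum R A \<iota> x ?c =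
      (\<Oplus>\<^bsub>A\<^esub>i\<in>{..max m n}. \<iota> (?c i) \<otimes>\<^bsub>A\<^esub> x [^]\<^bsub>A\<^esub> i)"
    using mn by (intro skew_ore_sum_bound c) auto
  also have "\<dots> = (\<Oplus>\<^bsub>A\<^esub>i\<in>{..max m n}. \<iota> (coeff a i) \<otimes>\<^bsub>A\<^esub> x [^]\<^bsub>A\<^esub> i) \<oplus>\<^bsub>A\<^esub>
      (\<Oplus>\<^bsub>A\<^esub>i\<in>{..max m n}. \<iota> (coeff b i) \<otimes>\<^bsub>A\<^esub> x [^]\<^bsub>A\<^esub> i)"
    using assms by (subst A.finsum_addf[symmetric])
      (auto intro!: A.finsum_cong' simp: A.l_distr)
  also have "\<dots> = a \<oplus>\<^bsub>A\<^esub> b"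
    using assms mn by (simp add: skew_ore_sum_bound[symmetric] coeff_up skew_ore_sum_coeff)
  finally show ?thesis using coeff_skew_ore_sum[OF c] by simp
qed

lemma coeff_embed_mult [simp]:
  assumes "r \<in> carrier R" "a \<in> carrier A"
  shows "coeff (\<iota> r \<otimes>\<^bsub>A\<^esub> a) i = r \<otimes>\<^bsub>R\<^esub> coeff a i"
proof -
  obtain n where n: "\<forall>i>n. coeff a i = \<zero>\<^bsub>R\<^esub>"
    using assms(2)[THEN coeff_up] by (auto simp: up_iff)
  let ?c = "\<lambda>i. r \<otimes>\<^bsub>R\<^esub> coeff a i"
  have c: "?c \<in> up R" using coeff_up[OF assms(2)] by (rule up_mono) (use assms in auto)
  have "skew_ore_sum R A \<iota> x ?c = (\<Oplus>\<^bsub>A\<^esub>i\<in>{..n}. \<iota> (?c i) \<otimes>\<^bsub>A\<^esub> x [^]\<^bsub>A\<^esub> i)"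
    using n assms by (intro skew_ore_sum_bound c) auto
  also have "\<dots> = \<iota> r \<otimes>\<^bsub>A\<^esub> (\<Oplus>\<^bsub>A\<^esub>i\<in>{..n}. \<iota> (coeff a i) \<otimes>\<^bsub>A\<^esub> x [^]\<^bsub>A\<^esub> i)"
    using assms by (subst A.finsum_rdistr)
      (auto intro!: A.finsum_cong' simp: A.m_assoc)
  also have "\<dots> = \<iota> r \<otimes>\<^bsub>A\<^esub> a"
    using assms n by (simp add: skew_ore_sum_bound[symmetric] coeff_up skew_ore_sum_coeff)
  finally show ?thesis using coeff_skew_ore_sum[OF c] by simp
qed

lemma coeff_embed:
  assumes "r \<in> carrier R"
  shows "coeff (\<iota> r) = (\<lambda>i. if i = 0 then r else \<zero>\<^bsub>R\<^esub>)"
proof -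
  let ?c = "\<lambda>i::nat. if i = 0 then r else \<zero>\<^bsub>R\<^esub>"
  have c: "?c \<in> up R" using assms by (auto simp: up_iff)
  have "skew_ore_sum R A \<iota> x ?c = (\<Oplus>\<^bsub>A\<^esub>i\<in>{..0}. \<iota> (?c i) \<otimes>\<^bsub>A\<^esub> x [^]\<^bsub>A\<^esub> i)"
    by (intro skew_ore_sum_bound c) auto
  also have "\<dots> = \<iota> r" using assms by simp
  finally show ?thesis using coeff_skew_ore_sum[OF c] by simp
qed

lemma coeff_zero [simp]: "coeff \<zero>\<^bsub>A\<^esub> i = \<zero>\<^bsub>R\<^esub>"
  using coeff_embed[of "\<zero>\<^bsub>R\<^esub>"] by simp

lemma coeff_uminus [simp]:
  assumes "a \<in> carrier A"
  shows "coeff (\<ominus>\<^bsub>A\<^esub> a) i = \<ominus>\<^bsub>R\<^esub> coeff a i"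
proof -
  have "coeff (\<ominus>\<^bsub>A\<^esub> a) i \<oplus>\<^bsub>R\<^esub> coeff a i = \<zero>\<^bsub>R\<^esub>"
    using assms coeff_add[of "\<ominus>\<^bsub>A\<^esub> a" a i] by (simp add: A.l_neg)
  then show ?thesis using assms R.minus_equality by simp
qed

text \<open>The case of index 0 matters most later: elements of Ax have constant term zero.\<close>

lemma coeff_mult_x:
  assumes "a \<in> carrier A"
  shows "coeff (a \<otimes>\<^bsub>A\<^esub> x) = case_nat \<zero>\<^bsub>R\<^esub> (coeff a)"
proof -
  obtain n where n: "\<forall>i>n. coeff a i = \<zero>\<^bsub>R\<^esub>"
    using assms[THEN coeff_up] by (auto simp: up_iff)
  let ?c = "case_nat \<zero>\<^bsub>R\<^esub> (coeff a)"
  have c: "?c \<in> up R" using coeff_up[OF assms] by (rule up_case_nat) simp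
  have ci: "?c i \<in> carrier R" for i using c by (simp add: up_iff)
  have "skew_ore_sum R A \<iota> x ?c = (\<Oplus>\<^bsub>A\<^esub>i\<in>{..Suc n}. \<iota> (?c i) \<otimes>\<^bsub>A\<^esub> x [^]\<^bsub>A\<^esub> i)"
    using n by (intro skew_ore_sum_bound c) (auto split: nat.split)
  also have "\<dots> = (\<Oplus>\<^bsub>A\<^esub>i\<in>{..n}. \<iota> (coeff a i) \<otimes>\<^bsub>A\<^esub> x [^]\<^bsub>A\<^esub> i \<otimes>\<^bsub>A\<^esub> x)"
    using assms ci x_closed by (subst A.finsum_Suc2) (auto simp: A.m_assoc)
  also have "\<dots> = (\<Oplus>\<^bsub>A\<^esub>i\<in>{..n}. \<iota> (coeff a i) \<otimes>\<^bsub>A\<^esub> x [^]\<^bsub>A\<^esub> i) \<otimes>\<^bsub>A\<^esub> x"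
    using assms x_closed by (subst A.finsum_ldistr) auto
  also have "\<dots> = a \<otimes>\<^bsub>A\<^esub> x"
    using assms n by (simp add: skew_ore_sum_bound[symmetric] coeff_up skew_ore_sum_coeff)
  finally show ?thesis using coeff_skew_ore_sum[OF c] by simp
qed

lemma coeff_mult_x_pow:
  assumes "a \<in> carrier A"
  shows "coeff (a \<otimes>\<^bsub>A\<^esub> x [^]\<^bsub>A\<^esub> (n::nat)) i = (if i < n then \<zero>\<^bsub>R\<^esub> else coeff a (i - n))"
proof (induction n arbitrary: i)
  case (Suc n)
  have "a \<otimes>\<^bsub>A\<^esub> x [^]\<^bsub>A\<^esub> Suc n = (a \<otimes>\<^bsub>A\<^esub> x [^]\<^bsub>A\<^esub> n) \<otimes>\<^bsub>A\<^esub> x"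
    using assms x_closed by (simp add: A.m_assoc)
  then show ?case using assms x_closed Suc by (simp add: coeff_mult_x split: nat.split)
qed (use assms in simp)

lemma tail_decomposition:
  assumes "a \<in> carrier A"
  obtains s b where "s \<in> carrier A" "b \<in> carrier A" "a = s \<oplus>\<^bsub>A\<^esub> b \<otimes>\<^bsub>A\<^esub> x [^]\<^bsub>A\<^esub> (n::nat)"
    "\<And>i. coeff s i = (if i < n then coeff a i else \<zero>\<^bsub>R\<^esub>)" "\<And>i. coeff b i = coeff a (i + n)"
proof -
  obtain b where b: "b \<in> carrier A" "coeff b = (\<lambda>i. coeff a (i + n))"
    using coeff_surj[OF up_shift[OF coeff_up[OF assms]]] by blast
  have "(\<lambda>i. if i < n then coeff a i else \<zero>\<^bsub>R\<^esub>) \<in> up R"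
    using coeff_up[OF assms] by (rule up_mono) (use assms in auto)
  then obtain s where s: "s \<in> carrier A" "coeff s = (\<lambda>i. if i < n then coeff a i else \<zero>\<^bsub>R\<^esub>)"
    using coeff_surj by blast
  have "a = s \<oplus>\<^bsub>A\<^esub> b \<otimes>\<^bsub>A\<^esub> x [^]\<^bsub>A\<^esub> n"
    by (rule coeff_eqI) (use assms s b in \<open>auto simp: coeff_mult_x_pow\<close>)
  with s b that show thesis by auto
qed

lemma head_decomposition:
  assumes "a \<in> carrier A"
  obtains b where "b \<in> carrier A" "a = \<iota> (coeff a 0) \<oplus>\<^bsub>A\<^esub> b \<otimes>\<^bsub>A\<^esub> x"
    "\<And>i. coeff b i = coeff a (Suc i)"
proof -
  obtain b where b: "b \<in> carrier A" "coeff b = (\<lambda>i. coeff a (i + 1))"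
    using coeff_surj[OF up_shift[OF coeff_up[OF assms]]] by blast
  have "a = \<iota> (coeff a 0) \<oplus>\<^bsub>A\<^esub> b \<otimes>\<^bsub>A\<^esub> x"
    by (rule coeff_eqI)
      (use assms b x_closed in \<open>auto simp: coeff_mult_x coeff_embed split: nat.split\<close>)
  with b that show thesis by auto
qed

text \<open>Horner induction: removing the constant term and then a right factor x shortens the
  coefficient sequence. The set \<open>T\<close> keeps a restriction on the coefficients available
  in every step, so that one rule serves both the whole ring and the elements with coefficients in
  an ideal.\<close>

lemma skew_ore_induct [consumes 2, case_names zero step]:
  assumes "a \<in> carrier A" "\<And>i. coeff a i \<in> T"
    and zero: "Q \<zero>\<^bsub>A\<^esub>"
    and step: "\<And>r b. \<lbrakk>r \<in> T; r \<in> carrier R; b \<in> carrier A; \<And>i. coeff b i \<in> T; Q b\<rbrakk>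
      \<Longrightarrow> Q (\<iota> r \<oplus>\<^bsub>A\<^esub> b \<otimes>\<^bsub>A\<^esub> x)"
  shows "Q a"
proof -
  obtain n where "\<forall>i>n. coeff a i = \<zero>\<^bsub>R\<^esub>"
    using assms(1)[THEN coeff_up] by (auto simp: up_iff)
  \<comment> \<open>The bound is made nonstrict so that the base case \<open>n = 0\<close> means
    \<open>a = 0\<close>.\<close>
  then have "\<exists>n. \<forall>i\<ge>n. coeff a i = \<zero>\<^bsub>R\<^esub>" by (intro exI[of _ "Suc n"]) simp
  then obtain n where "\<forall>i\<ge>n. coeff a i = \<zero>\<^bsub>R\<^esub>" by blast
  then show ?thesis using assms(1,2)
  proof (induction n arbitrary: a)
    case 0
    then have "a = \<zero>\<^bsub>A\<^esub>" by (intro coeff_eqI) auto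
    then show ?case using zero by simp
  next
    case (Suc n)
    obtain b where b: "b \<in> carrier A" "a = \<iota> (coeff a 0) \<oplus>\<^bsub>A\<^esub> b \<otimes>\<^bsub>A\<^esub> x"
      "\<And>i. coeff b i = coeff a (Suc i)"
      using head_decomposition[OF Suc.prems(2)] by blast
    have "Q b" using b Suc.prems by (intro Suc.IH) auto
    then have "Q (\<iota> (coeff a 0) \<oplus>\<^bsub>A\<^esub> b \<otimes>\<^bsub>A\<^esub> x)"
      using b(1,3) Suc.prems by (intro step) auto
    then show ?case using b(2) by (rule back_subst[OF _ sym])
  qed
qed

text \<open>Both summands of x r in the commutation rule end in x, and so does the remaining part of
  \<open>a\<close>; hence xA is contained in Ax.\<close>

lemma x_mult_swap_weak:
  assumes "a \<in> carrier A" "\<sigma> \<in> carrier R \<rightarrow> carrier R" "\<delta> \<in> carrier R \<rightarrow> carrier R"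
  shows "\<exists>b\<in>carrier A. x \<otimes>\<^bsub>A\<^esub> a = b \<otimes>\<^bsub>A\<^esub> x"
proof -
  obtain b where b: "b \<in> carrier A" "a = \<iota> (coeff a 0) \<oplus>\<^bsub>A\<^esub> b \<otimes>\<^bsub>A\<^esub> x"
    using head_decomposition[OF assms(1)] by blast
  let ?r = "coeff a 0"
  have r: "\<sigma> ?r \<in> carrier R" "\<delta> ?r \<in> carrier R" using assms by auto
  have "x \<otimes>\<^bsub>A\<^esub> a = x \<otimes>\<^bsub>A\<^esub> \<iota> ?r \<oplus>\<^bsub>A\<^esub> x \<otimes>\<^bsub>A\<^esub> (b \<otimes>\<^bsub>A\<^esub> x)"
    using b assms x_closed by (metis A.m_closed A.r_distr coeff_closed emb.hom_closed)
  also have "x \<otimes>\<^bsub>A\<^esub> \<iota> ?r = \<iota> (\<sigma> ?r) \<otimes>\<^bsub>A\<^esub> x \<oplus>\<^bsub>A\<^esub> x \<otimes>\<^bsub>A\<^esub> \<iota> (\<delta> ?r) \<otimes>\<^bsub>A\<^esub> x"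
    using assms by (intro commutation coeff_closed)
  also have "\<dots> \<oplus>\<^bsub>A\<^esub> x \<otimes>\<^bsub>A\<^esub> (b \<otimes>\<^bsub>A\<^esub> x) = (\<iota> (\<sigma> ?r) \<oplus>\<^bsub>A\<^esub> x \<otimes>\<^bsub>A\<^esub> \<iota> (\<delta> ?r) \<oplus>\<^bsub>A\<^esub> x \<otimes>\<^bsub>A\<^esub> b) \<otimes>\<^bsub>A\<^esub> x"
    using b(1) x_closed r by (simp add: A.l_distr A.m_assoc)
  finally show ?thesis by (rule bexI) (use b(1) r x_closed in simp)
qed

end

section \<open>Moving powers of x to the right, with control of constant terms\<close>

locale skew_ore_poly_ring = skew_ore_ring +
  assumes sigma_iso: "\<sigma> \<in> ring_iso R R"
    and skew_deriv: "skew_derivation R \<sigma> \<delta>"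
    and loc_nilpotent: "locally_nilpotent R \<delta>"
begin

lemma sigma_closed [simp]: "r \<in> carrier R \<Longrightarrow> \<sigma> r \<in> carrier R"
  using sigma_iso by (auto simp: ring_iso_def ring_hom_def)

lemma delta_closed [simp]: "r \<in> carrier R \<Longrightarrow> \<delta> r \<in> carrier R"
  using skew_deriv by (auto simp: skew_derivation_def)

lemma sigma_pow_closed [simp]: "r \<in> carrier R \<Longrightarrow> (\<sigma> ^^ n) r \<in> carrier R"
  by (induction n) auto

lemma sigma_pow_mult:
  "\<lbrakk>r \<in> carrier R; s \<in> carrier R\<rbrakk> \<Longrightarrow> (\<sigma> ^^ n) (r \<otimes>\<^bsub>R\<^esub> s) = (\<sigma> ^^ n) r \<otimes>\<^bsub>R\<^esub> (\<sigma> ^^ n) s"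
  using sigma_iso by (induction n) (auto simp: ring_iso_def ring_hom_mult)

lemma sigma_bij: "bij_betw \<sigma> (carrier R) (carrier R)"
  using sigma_iso by (simp add: ring_iso_def)

lemma sigma_pow_surj: "r \<in> carrier R \<Longrightarrow> \<exists>s\<in>carrier R. (\<sigma> ^^ n) s = r"
proof (induction n arbitrary: r)
  case (Suc n)
  then obtain t where "t \<in> carrier R" "\<sigma> t = r"
    using sigma_bij by (metis bij_betw_imp_surj_on imageE)
  with Suc show ?case by fastforce
qed auto

text \<open>In the cofactor \<open>?c\<close> every summand except
  \<open>\<iota> (\<sigma> ?r)\<close> lies in xA. By the weak version such elements lie in Ax and
  have constant term zero, which determines the constant term of \<open>?c\<close>.\<close>

lemma x_mult_swap:
  assumes "a \<in> carrier A"
  shows "\<exists>b\<in>carrier A. x \<otimes>\<^bsub>A\<^esub> a = b \<otimes>\<^bsub>A\<^esub> x \<and> coeff b 0 = \<sigma> (coeff a 0)"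
proof -
  have weak: "\<exists>b\<in>carrier A. x \<otimes>\<^bsub>A\<^esub> c = b \<otimes>\<^bsub>A\<^esub> x" if "c \<in> carrier A" for c
    using that by (intro x_mult_swap_weak) auto
  have zero: "coeff (x \<otimes>\<^bsub>A\<^esub> c) 0 = \<zero>\<^bsub>R\<^esub>" if "c \<in> carrier A" for c
    using weak[OF that] by (auto simp: coeff_mult_x)
  obtain b where b: "b \<in> carrier A" "a = \<iota> (coeff a 0) \<oplus>\<^bsub>A\<^esub> b \<otimes>\<^bsub>A\<^esub> x"
    using head_decomposition[OF assms(1)] by blast
  let ?r = "coeff a 0"
  let ?c = "\<iota> (\<sigma> ?r) \<oplus>\<^bsub>A\<^esub> (x \<otimes>\<^bsub>A\<^esub> \<iota> (\<delta> ?r) \<oplus>\<^bsub>A\<^esub> x \<otimes>\<^bsub>A\<^esub> b)"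
  have "x \<otimes>\<^bsub>A\<^esub> a = x \<otimes>\<^bsub>A\<^esub> \<iota> ?r \<oplus>\<^bsub>A\<^esub> x \<otimes>\<^bsub>A\<^esub> (b \<otimes>\<^bsub>A\<^esub> x)"
    using b assms x_closed by (metis A.m_closed A.r_distr coeff_closed emb.hom_closed)
  also have "x \<otimes>\<^bsub>A\<^esub> \<iota> ?r = \<iota> (\<sigma> ?r) \<otimes>\<^bsub>A\<^esub> x \<oplus>\<^bsub>A\<^esub> x \<otimes>\<^bsub>A\<^esub> \<iota> (\<delta> ?r) \<otimes>\<^bsub>A\<^esub> x"
    using assms by (intro commutation coeff_closed)
  also have "\<dots> \<oplus>\<^bsub>A\<^esub> x \<otimes>\<^bsub>A\<^esub> (b \<otimes>\<^bsub>A\<^esub> x) = ?c \<otimes>\<^bsub>A\<^esub> x"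
    using b(1) assms x_closed by (simp add: A.l_distr A.m_assoc A.a_assoc)
  finally have "x \<otimes>\<^bsub>A\<^esub> a = ?c \<otimes>\<^bsub>A\<^esub> x" .
  moreover have "coeff ?c 0 = \<sigma> ?r"
    using b(1) assms x_closed by (simp add: zero coeff_embed)
  moreover have "?c \<in> carrier A" using b(1) assms x_closed by simp
  ultimately show ?thesis by blast
qed

lemma x_pow_mult_swap:
  assumes "a \<in> carrier A"
  shows "\<exists>b\<in>carrier A. x [^]\<^bsub>A\<^esub> n \<otimes>\<^bsub>A\<^esub> a = b \<otimes>\<^bsub>A\<^esub> x [^]\<^bsub>A\<^esub> n \<and> coeff b 0 = (\<sigma> ^^ n) (coeff a 0)"
  using assms
proof (induction n arbitrary: a)
  case (Suc n)
  obtain b where b: "b \<in> carrier A" "x \<otimes>\<^bsub>A\<^esub> a = b \<otimes>\<^bsub>A\<^esub> x" "coeff b 0 = \<sigma> (coeff a 0)"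
    using x_mult_swap[OF Suc.prems] by blast
  obtain c where c: "c \<in> carrier A" "x [^]\<^bsub>A\<^esub> n \<otimes>\<^bsub>A\<^esub> b = c \<otimes>\<^bsub>A\<^esub> x [^]\<^bsub>A\<^esub> n"
    "coeff c 0 = (\<sigma> ^^ n) (coeff b 0)"
    using Suc.IH[OF b(1)] by blast
  have "x [^]\<^bsub>A\<^esub> Suc n \<otimes>\<^bsub>A\<^esub> a = x [^]\<^bsub>A\<^esub> n \<otimes>\<^bsub>A\<^esub> (x \<otimes>\<^bsub>A\<^esub> a)"
    using Suc.prems x_closed by (simp add: A.m_assoc)
  also have "\<dots> = (x [^]\<^bsub>A\<^esub> n \<otimes>\<^bsub>A\<^esub> b) \<otimes>\<^bsub>A\<^esub> x"
    unfolding b(2) using b(1) x_closed by (simp add: A.m_assoc)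
  also have "\<dots> = c \<otimes>\<^bsub>A\<^esub> x [^]\<^bsub>A\<^esub> Suc n"
    unfolding c(2) using c(1) x_closed by (simp add: A.m_assoc)
  finally show ?case using b c by (auto simp: funpow_swap1)
qed auto

text \<open>Modulo Ax only constant terms survive, and Ax absorbs right multiplication since xA is
  contained in Ax.\<close>

lemma coeff_mult_0:
  assumes "a \<in> carrier A" "b \<in> carrier A"
  shows "coeff (a \<otimes>\<^bsub>A\<^esub> b) 0 = coeff a 0 \<otimes>\<^bsub>R\<^esub> coeff b 0"
proof -
  obtain c where c: "c \<in> carrier A" "a = \<iota> (coeff a 0) \<oplus>\<^bsub>A\<^esub> c \<otimes>\<^bsub>A\<^esub> x"
    using head_decomposition[OF assms(1)] by blast
  obtain d where d: "d \<in> carrier A" "x \<otimes>\<^bsub>A\<^esub> b = d \<otimes>\<^bsub>A\<^esub> x"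
    using x_mult_swap[OF assms(2)] by blast
  have "a \<otimes>\<^bsub>A\<^esub> b = \<iota> (coeff a 0) \<otimes>\<^bsub>A\<^esub> b \<oplus>\<^bsub>A\<^esub> c \<otimes>\<^bsub>A\<^esub> (x \<otimes>\<^bsub>A\<^esub> b)"
    by (subst c(2)) (use c(1) assms x_closed in \<open>simp add: A.l_distr A.m_assoc\<close>)
  also have "\<dots> = \<iota> (coeff a 0) \<otimes>\<^bsub>A\<^esub> b \<oplus>\<^bsub>A\<^esub> (c \<otimes>\<^bsub>A\<^esub> d) \<otimes>\<^bsub>A\<^esub> x"
    unfolding d(2) using c(1) d(1) x_closed by (simp add: A.m_assoc)
  finally show ?thesis using assms c(1) d(1) x_closed by (simp add: coeff_mult_x)
qed

end

section \<open>Extension of stable prime ideals\<close>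

text \<open>Instead of the ideals generated by \<open>a\<close> and \<open>b\<close>,
  annihilator-like ideals are used: \<open>J\<close> collects all c with aRc in \<open>P\<close>,
  and \<open>I\<close> all c with cRJ in \<open>P\<close>. Both are two-sided, IJ lies in
  \<open>P\<close>, and they contain \<open>b\<close> and \<open>a\<close> respectively.\<close>

lemma nc_prime_ideal_elementwise:
  assumes "ring R" "nc_prime_ideal R P" "a \<in> carrier R" "b \<in> carrier R"
    and prod: "\<And>r. r \<in> carrier R \<Longrightarrow> a \<otimes>\<^bsub>R\<^esub> r \<otimes>\<^bsub>R\<^esub> b \<in> P"
  shows "a \<in> P \<or> b \<in> P"
proof -
  interpret R: ring R by fact
  interpret P: ideal P R using assms(2) by (simp add: nc_prime_ideal_def)
  define J where "J = {c \<in> carrier R. \<forall>r\<in>carrier R. a \<otimes>\<^bsub>R\<^esub> r \<otimes>\<^bsub>R\<^esub> c \<in> P}"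
  define I where "I = {c \<in> carrier R. \<forall>r\<in>carrier R. \<forall>d\<in>J. c \<otimes>\<^bsub>R\<^esub> r \<otimes>\<^bsub>R\<^esub> d \<in> P}"
  have J: "ideal J R"
  proof (rule idealI)
    show "subgroup J (add_monoid R)"
      by (rule R.add.subgroupI)
        (use assms(3) in \<open>auto simp: J_def R.r_distr R.r_minus intro: exI[of _ "\<zero>\<^bsub>R\<^esub>"]\<close>)
  next
    fix c s assume "c \<in> J" "s \<in> carrier R"
    then have c: "c \<in> carrier R" "s \<in> carrier R"
      and cP: "\<And>r. r \<in> carrier R \<Longrightarrow> a \<otimes>\<^bsub>R\<^esub> r \<otimes>\<^bsub>R\<^esub> c \<in> P"
      by (auto simp: J_def)
    have "a \<otimes>\<^bsub>R\<^esub> r \<otimes>\<^bsub>R\<^esub> (s \<otimes>\<^bsub>R\<^esub> c) \<in> P" if "r \<in> carrier R" for r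
      using cP[of "r \<otimes>\<^bsub>R\<^esub> s"] c that assms(3) by (simp add: R.m_assoc)
    with c show "s \<otimes>\<^bsub>R\<^esub> c \<in> J" by (simp add: J_def)
    have "a \<otimes>\<^bsub>R\<^esub> r \<otimes>\<^bsub>R\<^esub> (c \<otimes>\<^bsub>R\<^esub> s) \<in> P" if "r \<in> carrier R" for r
      using P.I_r_closed[OF cP[OF that] c(2)] c that assms(3) by (simp add: R.m_assoc)
    with c show "c \<otimes>\<^bsub>R\<^esub> s \<in> J" by (simp add: J_def)
  qed (rule assms(1))
  have I: "ideal I R"
  proof (rule idealI)
    show "subgroup I (add_monoid R)"
      by (rule R.add.subgroupI)
        (use ideal.Icarr[OF J] in \<open>auto simp: I_def R.l_distr R.l_minus intro: exI[of _ "\<zero>\<^bsub>R\<^esub>"]\<close>)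
  next
    fix c s assume "c \<in> I" "s \<in> carrier R"
    then have c: "c \<in> carrier R" "s \<in> carrier R"
      and cP: "\<And>r d. \<lbrakk>r \<in> carrier R; d \<in> J\<rbrakk> \<Longrightarrow> c \<otimes>\<^bsub>R\<^esub> r \<otimes>\<^bsub>R\<^esub> d \<in> P"
      by (auto simp: I_def)
    have "c \<otimes>\<^bsub>R\<^esub> s \<otimes>\<^bsub>R\<^esub> r \<otimes>\<^bsub>R\<^esub> d \<in> P" if "r \<in> carrier R" "d \<in> J" for r d
      using cP[of "s \<otimes>\<^bsub>R\<^esub> r" d] c that ideal.Icarr[OF J] by (simp add: R.m_assoc)
    with c show "c \<otimes>\<^bsub>R\<^esub> s \<in> I" by (simp add: I_def)
    have "s \<otimes>\<^bsub>R\<^esub> c \<otimes>\<^bsub>R\<^esub> r \<otimes>\<^bsub>R\<^esub> d \<in> P" if "r \<in> carrier R" "d \<in> J" for r d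
      using P.I_l_closed[OF cP[OF that] c(2)] c that ideal.Icarr[OF J] by (simp add: R.m_assoc)
    with c show "s \<otimes>\<^bsub>R\<^esub> c \<in> I" by (simp add: I_def)
  qed (rule assms(1))
  have "c \<in> P" if "c \<in> ideal_prod R I J" for c
    using that
  proof (induction rule: ideal_prod.induct)
    case (prod i j)
    then have i: "i \<in> carrier R" "\<forall>r\<in>carrier R. \<forall>d\<in>J. i \<otimes>\<^bsub>R\<^esub> r \<otimes>\<^bsub>R\<^esub> d \<in> P"
      by (simp_all add: I_def)
    \<comment> \<open>The middle factor is taken to be one.\<close>
    show ?case using i(2)[rule_format, OF R.one_closed prod(2)] i(1) by simp
  qed auto
  then have "I \<subseteq> P \<or> J \<subseteq> P"
    using assms(2) I J unfolding nc_prime_ideal_def by blast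
  moreover have "a \<in> I" using assms(3) by (auto simp: I_def J_def)
  moreover have "b \<in> J" using assms(4) prod by (auto simp: J_def)
  ultimately show ?thesis by blast
qed

section \<open>The ideal PA for an ideal P that is stable under \<sigma>, its inverse and
  \<delta>\<close>

locale skew_ore_stable_ideal = skew_ore_poly_ring +
  fixes P
  assumes ideal_P: "ideal P R"
    and sigma_stable: "r \<in> carrier R \<Longrightarrow> \<sigma> r \<in> P \<longleftrightarrow> r \<in> P"
    and delta_stable: "r \<in> P \<Longrightarrow> \<delta> r \<in> P"
begin

sublocale P: ideal P R by (rule ideal_P)

text \<open>This is PA described by coefficients; \<open>right_ideal_generated_eq_extension\<close>
  identifies it with the generated right ideal.\<close>

definition extension where "extension = {a \<in> carrier A. \<forall>i. coeff a i \<in> P}"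

lemma extension_carrier: "a \<in> extension \<Longrightarrow> a \<in> carrier A"
  by (simp add: extension_def)

lemma extension_add: "\<lbrakk>a \<in> extension; b \<in> extension\<rbrakk> \<Longrightarrow> a \<oplus>\<^bsub>A\<^esub> b \<in> extension"
  by (simp add: extension_def)

lemma extension_zero: "\<zero>\<^bsub>A\<^esub> \<in> extension"
  by (simp add: extension_def)

lemma extension_subgroup: "subgroup extension (add_monoid A)"
  by (rule A.add.subgroupI)
    (use extension_zero in \<open>auto simp: extension_def\<close>)

lemma extension_embed: "r \<in> P \<Longrightarrow> \<iota> r \<in> extension"
  using P.Icarr by (simp add: extension_def coeff_embed)

lemma extension_mult_x:
  "a \<in> carrier A \<Longrightarrow> a \<otimes>\<^bsub>A\<^esub> x \<in> extension \<longleftrightarrow> a \<in> extension"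
  using x_closed by (auto simp: extension_def coeff_mult_x split: nat.split)

lemma embed_mult_extension: "\<lbrakk>r \<in> P; a \<in> carrier A\<rbrakk> \<Longrightarrow> \<iota> r \<otimes>\<^bsub>A\<^esub> a \<in> extension"
  using P.Icarr P.I_r_closed by (simp add: extension_def)

lemma extension_induct [consumes 1, case_names zero step]:
  assumes "a \<in> extension" "Q \<zero>\<^bsub>A\<^esub>"
    and "\<And>r b. \<lbrakk>r \<in> P; b \<in> extension; Q b\<rbrakk> \<Longrightarrow> Q (\<iota> r \<oplus>\<^bsub>A\<^esub> b \<otimes>\<^bsub>A\<^esub> x)"
  shows "Q a"
  by (rule skew_ore_induct[where T = P and a = a]) (use assms in \<open>auto simp: extension_def\<close>)

text \<open>Horner induction on the left factor: x moves across \<open>b\<close>, and the induction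
  hypothesis for \<open>c\<close> is applied to the cofactor \<open>d\<close>, which is why
  \<open>b\<close> is kept arbitrary.\<close>

lemma extension_r_closed:
  assumes "a \<in> extension" "b \<in> carrier A"
  shows "a \<otimes>\<^bsub>A\<^esub> b \<in> extension"
  using assms
proof (induction arbitrary: b rule: extension_induct)
  case (step r c)
  have c: "c \<in> carrier A" "r \<in> carrier R" using step extension_carrier P.Icarr by auto
  obtain d where d: "d \<in> carrier A" "x \<otimes>\<^bsub>A\<^esub> b = d \<otimes>\<^bsub>A\<^esub> x"
    using x_mult_swap step.prems by blast
  have "(\<iota> r \<oplus>\<^bsub>A\<^esub> c \<otimes>\<^bsub>A\<^esub> x) \<otimes>\<^bsub>A\<^esub> b = \<iota> r \<otimes>\<^bsub>A\<^esub> b \<oplus>\<^bsub>A\<^esub> c \<otimes>\<^bsub>A\<^esub> (x \<otimes>\<^bsub>A\<^esub> b)"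
    using c step.prems x_closed by (simp add: A.l_distr A.m_assoc)
  also have "\<dots> = \<iota> r \<otimes>\<^bsub>A\<^esub> b \<oplus>\<^bsub>A\<^esub> (c \<otimes>\<^bsub>A\<^esub> d) \<otimes>\<^bsub>A\<^esub> x"
    unfolding d(2) using c d(1) x_closed by (simp add: A.m_assoc)
  finally show ?case
    using step d(1) c by (simp add: extension_add extension_mult_x embed_mult_extension)
qed (simp add: extension_zero)

text \<open>Here local nilpotency enters. The commutation rule reduces x r to \<sigma>(r), which is
  in \<open>P\<close>, and to x \<delta>(r), so induction on the exponent at which \<delta> kills
  \<open>r\<close> ends at x 0.\<close>

lemma x_mult_embed_extension:
  assumes "r \<in> P"
  shows "x \<otimes>\<^bsub>A\<^esub> \<iota> r \<in> extension"
proof -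
  have "x \<otimes>\<^bsub>A\<^esub> \<iota> r \<in> extension" if "r \<in> P" "(\<delta> ^^ n) r = \<zero>\<^bsub>R\<^esub>" for n r
    using that
  proof (induction n arbitrary: r)
    case 0
    then show ?case using x_closed extension_zero by simp
  next
    case (Suc n)
    then have "x \<otimes>\<^bsub>A\<^esub> \<iota> (\<delta> r) \<in> extension"
      using delta_stable by (simp add: funpow_swap1)
    moreover have "\<iota> (\<sigma> r) \<in> extension"
      using Suc.prems sigma_stable P.Icarr extension_embed by blast
    ultimately show ?case
      using commutation[of r] Suc.prems P.Icarr x_closed
      by (simp add: extension_add extension_r_closed)
  qed
  moreover obtain n where "(\<delta> ^^ n) r = \<zero>\<^bsub>R\<^esub>"
    using loc_nilpotent P.Icarr[OF assms] by (auto simp: locally_nilpotent_def)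
  ultimately show ?thesis using assms by blast
qed

lemma x_mult_extension:
  assumes "a \<in> extension"
  shows "x \<otimes>\<^bsub>A\<^esub> a \<in> extension"
  using assms
proof (induction rule: extension_induct)
  case (step r b)
  then have "x \<otimes>\<^bsub>A\<^esub> (\<iota> r \<oplus>\<^bsub>A\<^esub> b \<otimes>\<^bsub>A\<^esub> x) = x \<otimes>\<^bsub>A\<^esub> \<iota> r \<oplus>\<^bsub>A\<^esub> (x \<otimes>\<^bsub>A\<^esub> b) \<otimes>\<^bsub>A\<^esub> x"
    using P.Icarr extension_carrier x_closed by (simp add: A.r_distr A.m_assoc)
  then show ?case
    using step x_closed by (simp add: extension_add extension_r_closed x_mult_embed_extension)
qed (use x_closed extension_zero in simp)

text \<open>Horner induction on the left factor \<open>b\<close>, with \<open>T\<close> the whole of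
  \<open>R\<close>; the factor x next to \<open>a\<close> is absorbed by
  \<open>x_mult_extension\<close>.\<close>

lemma extension_l_closed:
  assumes "b \<in> carrier A" "a \<in> extension"
  shows "b \<otimes>\<^bsub>A\<^esub> a \<in> extension"
proof -
  have "\<forall>a\<in>extension. b \<otimes>\<^bsub>A\<^esub> a \<in> extension"
    using assms(1) coeff_closed[OF assms(1)]
  proof (induction rule: skew_ore_induct[where T = "carrier R"])
    case (step r b)
    show ?case
    proof
      fix a assume a: "a \<in> extension"
      have "\<iota> r \<otimes>\<^bsub>A\<^esub> a \<in> extension"
        using a step P.I_l_closed by (auto simp: extension_def)
      moreover have "b \<otimes>\<^bsub>A\<^esub> (x \<otimes>\<^bsub>A\<^esub> a) \<in> extension"
        using step a x_mult_extension by blast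
      ultimately show "(\<iota> r \<oplus>\<^bsub>A\<^esub> b \<otimes>\<^bsub>A\<^esub> x) \<otimes>\<^bsub>A\<^esub> a \<in> extension"
        using step a x_closed extension_carrier by (simp add: A.l_distr A.m_assoc extension_add)
    qed
  qed (use assms(1) extension_carrier extension_zero in auto)
  then show ?thesis using assms(2) by blast
qed

lemma extension_ideal: "ideal extension A"
  using A.ring_axioms extension_subgroup extension_l_closed extension_r_closed by (rule idealI)

lemma extension_additive_subgroup: "additive_subgroup extension A"
  using extension_ideal by (rule ideal.axioms(1))

text \<open>Horner steps use only elements of \<open>\<iota>\<close> P\<open>, sums and right
  multiplication by x, so they stay inside every right ideal containing\<close>\<iota>
  \<open>P\<close>.\<close>

lemma right_ideal_generated_eq_extension: "right_ideal_generated A (\<iota> ` P) = extension"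
proof
  have "right_ideal A extension"
    using extension_additive_subgroup extension_r_closed by (simp add: right_ideal_def)
  then show "right_ideal_generated A (\<iota> ` P) \<subseteq> extension"
    using extension_embed by (auto simp: right_ideal_generated_def)
next
  have "a \<in> I" if "a \<in> extension" "right_ideal A I" "\<iota> ` P \<subseteq> I" for a I
    using that(1)
  proof (induction rule: extension_induct)
    case zero
    show ?case using that(2) additive_subgroup.zero_closed by (auto simp: right_ideal_def)
  next
    case (step r b)
    then show ?case
      using that(2,3) x_closed additive_subgroup.a_closed[of I A] by (auto simp: right_ideal_def)
  qed
  then show "extension \<subseteq> right_ideal_generated A (\<iota> ` P)"
    by (auto simp: right_ideal_generated_def)
qed

text \<open>Modulo the extension, an element outside it is \<open>b x\<^sup>n\<close>, where the constant term of \<open>b\<close> is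
  its lowest coefficient outside \<open>P\<close>.\<close>

lemma lowest_coeff:
  assumes "a \<in> carrier A" "a \<notin> extension"
  obtains n s b where "s \<in> extension" "b \<in> carrier A" "coeff b 0 \<notin> P"
    "a = s \<oplus>\<^bsub>A\<^esub> b \<otimes>\<^bsub>A\<^esub> x [^]\<^bsub>A\<^esub> (n::nat)"
proof -
  define n where "n = (LEAST i. coeff a i \<notin> P)"
  have "\<exists>i. coeff a i \<notin> P" using assms by (simp add: extension_def)
  then have n: "coeff a n \<notin> P" unfolding n_def by (rule LeastI_ex)
  have less: "coeff a i \<in> P" if "i < n" for i
    using that not_less_Least unfolding n_def by blast
  obtain s b where "s \<in> carrier A" "b \<in> carrier A" "a = s \<oplus>\<^bsub>A\<^esub> b \<otimes>\<^bsub>A\<^esub> x [^]\<^bsub>A\<^esub> n"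
    and s: "\<And>i. coeff s i = (if i < n then coeff a i else \<zero>\<^bsub>R\<^esub>)"
    and b: "\<And>i. coeff b i = coeff a (i + n)"
    using tail_decomposition[OF assms(1), of n] by blast
  moreover have "s \<in> extension" using s less \<open>s \<in> carrier A\<close> by (simp add: extension_def)
  moreover have "coeff b 0 \<notin> P" using b n by simp
  ultimately show thesis using that by blast
qed

lemma sigma_pow_stable: "r \<in> carrier R \<Longrightarrow> (\<sigma> ^^ n) r \<in> P \<longleftrightarrow> r \<in> P"
  by (induction n) (auto simp: sigma_stable)

text \<open>Take \<open>f\<close> in \<open>I\<close> and \<open>g\<close> in \<open>J\<close>
  outside the extension, with lowest coefficients outside \<open>P\<close> at places m and n.
  Looking at place m + n of the products f r' g yields products of these coefficients, twisted by
  \<sigma>^m, which must lie in \<open>P\<close>; elementwise primeness of \<open>P\<close> then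
  gives a contradiction.\<close>

lemma extension_prime:
  assumes "nc_prime_ideal R P"
  shows "nc_prime_ideal A extension"
  unfolding nc_prime_ideal_def
proof (intro conjI allI impI)
  show "ideal extension A" by (rule extension_ideal)
  have "\<one>\<^bsub>R\<^esub> \<notin> P"
    using assms P.one_imp_carrier by (auto simp: nc_prime_ideal_def)
  then have "\<iota> \<one>\<^bsub>R\<^esub> \<notin> extension"
    by (auto simp: extension_def coeff_embed simp del: emb.hom_one intro: exI[of _ 0])
  then show "extension \<noteq> carrier A" using emb.hom_closed R.one_closed by metis
next
  fix I J assume IJ: "ideal I A \<and> ideal J A \<and> ideal_prod A I J \<subseteq> extension"
  interpret I: ideal I A using IJ by simp
  interpret J: ideal J A using IJ by simp
  show "I \<subseteq> extension \<or> J \<subseteq> extension"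
  proof (rule ccontr)
    assume "\<not> (I \<subseteq> extension \<or> J \<subseteq> extension)"
    then obtain f g where fg: "f \<in> I" "f \<notin> extension" "g \<in> J" "g \<notin> extension" by blast
    obtain m s b where f: "s \<in> extension" "b \<in> carrier A" "coeff b 0 \<notin> P"
      "f = s \<oplus>\<^bsub>A\<^esub> b \<otimes>\<^bsub>A\<^esub> x [^]\<^bsub>A\<^esub> (m::nat)"
      by (rule lowest_coeff[OF I.Icarr[OF fg(1)] fg(2)])
    obtain n t c where g: "t \<in> extension" "c \<in> carrier A" "coeff c 0 \<notin> P"
      "g = t \<oplus>\<^bsub>A\<^esub> c \<otimes>\<^bsub>A\<^esub> x [^]\<^bsub>A\<^esub> (n::nat)"
      by (rule lowest_coeff[OF J.Icarr[OF fg(3)] fg(4)])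
    have "coeff b 0 \<otimes>\<^bsub>R\<^esub> r \<otimes>\<^bsub>R\<^esub> (\<sigma> ^^ m) (coeff c 0) \<in> P" if r: "r \<in> carrier R" for r
    proof -
      \<comment> \<open>Crossing x^m turns the middle factor r' into \<sigma>^m(r'), so a preimage
        of \<open>r\<close> is inserted.\<close>
      obtain r' where r': "r' \<in> carrier R" "(\<sigma> ^^ m) r' = r" using sigma_pow_surj[OF r] by blast
      obtain d where d: "d \<in> carrier A" "coeff d 0 = (\<sigma> ^^ m) (r' \<otimes>\<^bsub>R\<^esub> coeff c 0)"
        "x [^]\<^bsub>A\<^esub> m \<otimes>\<^bsub>A\<^esub> (\<iota> r' \<otimes>\<^bsub>A\<^esub> c) = d \<otimes>\<^bsub>A\<^esub> x [^]\<^bsub>A\<^esub> m"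
        using x_pow_mult_swap[of "\<iota> r' \<otimes>\<^bsub>A\<^esub> c" m] r' g(2) by auto
      let ?f = "b \<otimes>\<^bsub>A\<^esub> x [^]\<^bsub>A\<^esub> m" and ?g = "\<iota> r' \<otimes>\<^bsub>A\<^esub> c \<otimes>\<^bsub>A\<^esub> x [^]\<^bsub>A\<^esub> n"
      have sc: "s \<in> carrier A" "t \<in> carrier A" using f(1) g(1) extension_carrier by auto
      have g': "\<iota> r' \<otimes>\<^bsub>A\<^esub> g = \<iota> r' \<otimes>\<^bsub>A\<^esub> t \<oplus>\<^bsub>A\<^esub> ?g"
        unfolding g(4) using g(2) sc r' by (simp add: A.r_distr A.m_assoc)
      have "\<iota> r' \<otimes>\<^bsub>A\<^esub> g \<in> J"
        by (rule J.I_l_closed[OF fg(3) emb.hom_closed[OF r'(1)]])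
      with fg(1) have "f \<otimes>\<^bsub>A\<^esub> (\<iota> r' \<otimes>\<^bsub>A\<^esub> g) \<in> ideal_prod A I J"
        by (rule ideal_prod.prod)
      then have "f \<otimes>\<^bsub>A\<^esub> (\<iota> r' \<otimes>\<^bsub>A\<^esub> g) \<in> extension"
        using IJ by (metis subsetD)
      \<comment> \<open>All terms containing \<open>s\<close> or \<open>t\<close> are collected in
        the second summand, which lies in the extension.\<close>
      moreover have "f \<otimes>\<^bsub>A\<^esub> (\<iota> r' \<otimes>\<^bsub>A\<^esub> g) =
          ?f \<otimes>\<^bsub>A\<^esub> ?g \<oplus>\<^bsub>A\<^esub> (s \<otimes>\<^bsub>A\<^esub> (\<iota> r' \<otimes>\<^bsub>A\<^esub> g) \<oplus>\<^bsub>A\<^esub> ?f \<otimes>\<^bsub>A\<^esub> (\<iota> r' \<otimes>\<^bsub>A\<^esub> t))"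
        unfolding g' f(4) using f(2) g(2) sc r'
        by (simp add: A.r_distr A.l_distr A.a_ac)
      moreover have "s \<otimes>\<^bsub>A\<^esub> (\<iota> r' \<otimes>\<^bsub>A\<^esub> g) \<oplus>\<^bsub>A\<^esub> ?f \<otimes>\<^bsub>A\<^esub> (\<iota> r' \<otimes>\<^bsub>A\<^esub> t) \<in> extension"
        using f(1,2) g(1,2) r' fg J.Icarr
        by (intro extension_add extension_r_closed extension_l_closed) auto
      ultimately have "?f \<otimes>\<^bsub>A\<^esub> ?g \<in> extension"
        using A.additive_subgroup_add_cancel[OF extension_additive_subgroup] f(2) g(2) r' by simp
      moreover have "?f \<otimes>\<^bsub>A\<^esub> ?g = (b \<otimes>\<^bsub>A\<^esub> d) \<otimes>\<^bsub>A\<^esub> x [^]\<^bsub>A\<^esub> (m + n)"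
      proof -
        have "?f \<otimes>\<^bsub>A\<^esub> ?g = b \<otimes>\<^bsub>A\<^esub> (x [^]\<^bsub>A\<^esub> m \<otimes>\<^bsub>A\<^esub> (\<iota> r' \<otimes>\<^bsub>A\<^esub> c)) \<otimes>\<^bsub>A\<^esub> x [^]\<^bsub>A\<^esub> n"
          using f(2) g(2) r' by (simp add: A.m_assoc)
        then show ?thesis
          unfolding d(3) using f(2) d(1) x_closed by (simp add: A.m_assoc A.nat_pow_mult[symmetric])
      qed
      \<comment> \<open>The coefficient at m + n is the constant term of bd, and constant terms are
        multiplicative.\<close>
      ultimately have "coeff ((b \<otimes>\<^bsub>A\<^esub> d) \<otimes>\<^bsub>A\<^esub> x [^]\<^bsub>A\<^esub> (m + n)) (m + n) \<in> P"
        by (simp add: extension_def)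
      then have "coeff b 0 \<otimes>\<^bsub>R\<^esub> coeff d 0 \<in> P"
        using f(2) d(1) by (simp add: coeff_mult_x_pow coeff_mult_0)
      then show ?thesis
        using r r' d(2) f(2) g(2) by (simp add: sigma_pow_mult R.m_assoc)
    qed
    then have "coeff b 0 \<in> P \<or> (\<sigma> ^^ m) (coeff c 0) \<in> P"
      using f(2) g(2) by (intro nc_prime_ideal_elementwise[OF R.ring_axioms assms]) auto
    then show False using f(3) g(2,3) sigma_pow_stable by simp
  qed
qed

end

section \<open>The inverse polynomial module\<close>

lemma (in abelian_group) finsum_in_subgroup:
  assumes "additive_subgroup N G" "\<And>k. k \<in> S \<Longrightarrow> g k \<in> N"
  shows "(\<Oplus>k\<in>S. g k) \<in> N"
  using assms(2)
\<comment> \<open>Over an infinite index set the sum is zero by default, which lies in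
  \<open>N\<close>.\<close>
proof (induction S rule: infinite_finite_induct)
  case (insert k S)
  then have "g k \<in> N" "(\<Oplus>k\<in>S. g k) \<in> N" by auto
  moreover have "g \<in> insert k S \<rightarrow> carrier G"
    using insert.prems additive_subgroup.a_Hcarr[OF assms(1)] by blast
  ultimately show ?case
    using insert.hyps additive_subgroup.a_closed[OF assms(1)] by (simp add: finsum_insert Pi_iff)
qed (use additive_subgroup.zero_closed[OF assms(1)] in auto)

text \<open>Isolates the one term that matters modulo \<open>N\<close>. The last hypothesis adapts
  it to sums over a support: an index missing from the support contributes zero.\<close>

lemma (in abelian_group) finsum_cong_subgroup:
  assumes N: "additive_subgroup N G" and "finite S" "\<And>k. g k \<in> carrier G"
    and "\<And>k. \<lbrakk>k \<in> S; k \<noteq> k0\<rbrakk> \<Longrightarrow> g k \<in> N" and "k0 \<notin> S \<Longrightarrow> g k0 = \<zero>"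
  shows "\<exists>n\<in>N. (\<Oplus>k\<in>S. g k) = g k0 \<oplus> n"
proof -
  have N': "(\<Oplus>k\<in>S - {k0}. g k) \<in> N"
    using assms(4) by (intro finsum_in_subgroup[OF N]) auto
  have "(\<Oplus>k\<in>S. g k) = g k0 \<oplus> (\<Oplus>k\<in>S - {k0}. g k)"
  proof (cases "k0 \<in> S")
    case True
    then have "(\<Oplus>k\<in>insert k0 (S - {k0}). g k) = g k0 \<oplus> (\<Oplus>k\<in>S - {k0}. g k)"
      using assms(2,3) by (intro finsum_insert) auto
    then show ?thesis using True by (simp add: insert_absorb)
  next
    case False
    then show ?thesis using assms(3,5) by simp
  qed
  with N' show ?thesis by blast
qed

section \<open>Words in the inverse of \<sigma> and the associated derivation\<close>

context skew_ore_poly_ring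
begin

abbreviation word_sum where "word_sum \<equiv> skew_word_sum R \<sigma> \<delta>"

lemma sigma'_closed [simp]: "r \<in> carrier R \<Longrightarrow> sigma' R \<sigma> r \<in> carrier R"
  using sigma_bij by (simp add: sigma'_def bij_betw_def inv_into_into)

lemma sigma_sigma' [simp]: "r \<in> carrier R \<Longrightarrow> \<sigma> (sigma' R \<sigma> r) = r"
  using sigma_bij by (simp add: sigma'_def bij_betw_def f_inv_into_f)

lemma sigma'_pow_closed [simp]: "r \<in> carrier R \<Longrightarrow> (sigma' R \<sigma> ^^ n) r \<in> carrier R"
  by (induction n) auto

lemma sigma'_pow_sigma_pow: "r \<in> carrier R \<Longrightarrow> (sigma' R \<sigma> ^^ n) ((\<sigma> ^^ n) r) = r"
proof (induction n arbitrary: r)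
  case (Suc n)
  have "sigma' R \<sigma> (\<sigma> s) = s" if "s \<in> carrier R" for s
    using sigma_bij that by (simp add: sigma'_def bij_betw_def inv_into_f_f)
  then show ?case using Suc by (simp add: funpow_swap1)
qed auto

lemma sigma_pow_sigma'_pow: "r \<in> carrier R \<Longrightarrow> (\<sigma> ^^ n) ((sigma' R \<sigma> ^^ n) r) = r"
proof (induction n arbitrary: r)
  case (Suc n)
  then show ?case using sigma_sigma' by (simp add: funpow_swap1[of "sigma' R \<sigma>"])
qed auto

lemma sigma_pow_zero: "(\<sigma> ^^ n) \<zero>\<^bsub>R\<^esub> = \<zero>\<^bsub>R\<^esub>"
  using ring_hom_zero[of \<sigma> R R] sigma_iso R.ring_axioms
  by (induction n) (auto simp: ring_iso_def)

lemma skew_word_closed: "r \<in> carrier R \<Longrightarrow> skew_word R \<sigma> \<delta> w r \<in> carrier R"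
  by (induction w) (auto simp: skew_word_def delta'_def)

lemma word_sum_closed [simp]: "r \<in> carrier R \<Longrightarrow> word_sum k i r \<in> carrier R"
  unfolding skew_word_sum_def by (intro R.finsum_closed) (auto simp: skew_word_closed)

text \<open>Only one word of length \<open>k\<close> consists entirely of letters \<sigma>'. This
  power of \<sigma>' is what acts on leading coefficients.\<close>

lemma word_sum_self:
  assumes "r \<in> carrier R"
  shows "word_sum k k r = (sigma' R \<sigma> ^^ k) r"
proof -
  have "w = replicate (length w) True" if "count_list w True = length w" for w :: "bool list"
    using that
  proof (induction w)
    case (Cons b w)
    then show ?case using count_le_length[of w True] by (auto split: if_splits)
  qed auto
  moreover have "count_list (replicate k True) True = k" by (induction k) auto
  ultimately have "{w. length w = k \<and> count_list w True = k} = {replicate k True}"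
    by auto
  moreover have "skew_word R \<sigma> \<delta> (replicate k True) r = (sigma' R \<sigma> ^^ k) r"
    by (induction k) (auto simp: skew_word_def)
  ultimately show ?thesis
    using assms by (simp add: skew_word_sum_def R.finsum_insert)
qed

end

context skew_ore_stable_ideal
begin

lemma sigma'_stable: "r \<in> P \<Longrightarrow> sigma' R \<sigma> r \<in> P"
  using sigma_stable[of "sigma' R \<sigma> r"] P.Icarr by simp

lemma word_sum_stable:
  assumes "r \<in> P"
  shows "word_sum k i r \<in> P"
proof -
  have "skew_word R \<sigma> \<delta> w r \<in> P" for w
    using assms by (induction w) (auto simp: skew_word_def delta'_def sigma'_stable delta_stable)
  then show ?thesis
    unfolding skew_word_sum_def by (intro R.finsum_in_subgroup P.is_additive_subgroup)
qed

end

lemma skew_ore_stable_idealI: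
  assumes "skew_ore_poly_ring R A \<sigma> \<delta> \<iota> x" "ideal P R"
    "\<And>r. r \<in> carrier R \<Longrightarrow> \<sigma> r \<in> P \<longleftrightarrow> r \<in> P" "\<And>r. r \<in> P \<Longrightarrow> \<delta> r \<in> P"
  shows "skew_ore_stable_ideal R A \<sigma> \<delta> \<iota> x P"
  using assms by (simp add: skew_ore_stable_ideal_def skew_ore_stable_ideal_axioms_def)

section \<open>The additive action of A on inverse polynomials\<close>

locale inverse_polynomials = skew_ore_poly_ring R A \<sigma> \<delta> \<iota> x + M?: right_module R M
  for R (structure) and A (structure) and \<sigma> \<delta> \<iota> x and M (structure)
begin

sublocale act: right_action R M
  using right_module_axioms by (rule right_module_imp_right_action)

abbreviation scale where "scale \<equiv> inv_poly_scale R \<sigma> \<delta> M"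

abbreviation Mx where "Mx \<equiv> inv_poly_module R A \<sigma> \<delta> \<iota> x M"

lemma Mx_simps:
  "carrier Mx = up M" "\<zero>\<^bsub>Mx\<^esub> = (\<lambda>i. \<zero>\<^bsub>M\<^esub>)" "p \<oplus>\<^bsub>Mx\<^esub> q = (\<lambda>i. p i \<oplus>\<^bsub>M\<^esub> q i)"
  "p \<bullet>\<^bsub>Mx\<^esub> a = (\<lambda>l. \<Oplus>\<^bsub>M\<^esub>j\<in>{j. coeff a j \<noteq> \<zero>\<^bsub>R\<^esub>}. scale p (coeff a j) (l + j))"
  by (simp_all add: inv_poly_module_def inv_poly_shift_def)

lemma up_coeff_closed: "p \<in> up M \<Longrightarrow> p i \<in> carrier M"
  by (simp add: up_iff)

lemma scale_term_closed:
  "\<lbrakk>p \<in> up M; r \<in> carrier R\<rbrakk> \<Longrightarrow> p k \<bullet>\<^bsub>M\<^esub> word_sum k i r \<in> carrier M"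
  by (simp add: up_coeff_closed act.act_closed)

lemma scale_closed: "\<lbrakk>p \<in> up M; r \<in> carrier R\<rbrakk> \<Longrightarrow> scale p r i \<in> carrier M"
  unfolding inv_poly_scale_def by (intro M.L.finsum_closed) (auto simp: scale_term_closed)

text \<open>As for elements of \<open>A\<close>, the support is replaced by an interval that can be
  shared by several polynomials; the extra terms vanish because zero acts to zero.\<close>

lemma scale_bound:
  assumes "p \<in> up M" "r \<in> carrier R" "\<forall>k>n. p k = \<zero>\<^bsub>M\<^esub>"
  shows "scale p r i = (\<Oplus>\<^bsub>M\<^esub>k\<in>{i..n}. p k \<bullet>\<^bsub>M\<^esub> word_sum k i r)"
  unfolding inv_poly_scale_def
proof (rule M.L.add.finprod_mono_neutral_cong_left)
  show "{k. p k \<noteq> \<zero>\<^bsub>M\<^esub> \<and> i \<le> k} \<subseteq> {i..n}" using assms by (auto simp: not_le[symmetric])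
  show "p k \<bullet>\<^bsub>M\<^esub> word_sum k i r = \<zero>\<^bsub>M\<^esub>" if "k \<in> {i..n} - {k. p k \<noteq> \<zero>\<^bsub>M\<^esub> \<and> i \<le> k}" for k
    using that assms act.act_zero by auto
qed (use assms scale_term_closed in auto)

lemma scale_add:
  assumes "p \<in> up M" "q \<in> up M" "r \<in> carrier R"
  shows "scale (\<lambda>i. p i \<oplus>\<^bsub>M\<^esub> q i) r i = scale p r i \<oplus>\<^bsub>M\<^esub> scale q r i"
proof -
  obtain m n where "\<forall>k>m. p k = \<zero>\<^bsub>M\<^esub>" "\<forall>k>n. q k = \<zero>\<^bsub>M\<^esub>" using assms by (auto simp: up_iff)
  then have "\<forall>k>max m n. p k = \<zero>\<^bsub>M\<^esub>" "\<forall>k>max m n. q k = \<zero>\<^bsub>M\<^esub>"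
    "\<forall>k>max m n. p k \<oplus>\<^bsub>M\<^esub> q k = \<zero>\<^bsub>M\<^esub>" by auto
  note b = scale_bound[OF assms(1,3) this(1)] scale_bound[OF assms(2,3) this(2)]
    scale_bound[OF M.L.up_add[OF assms(1,2)] assms(3) this(3)]
  show ?thesis
    unfolding b using assms
    by (subst M.L.finsum_addf[symmetric])
      (auto intro!: M.L.finsum_cong' simp: scale_term_closed up_coeff_closed act.act_closed act.act_l_distr)
qed

lemma scale_eq_zero:
  assumes "p \<in> up M" "r \<in> carrier R" "\<And>k. i \<le> k \<Longrightarrow> p k = \<zero>\<^bsub>M\<^esub>"
  shows "scale p r i = \<zero>\<^bsub>M\<^esub>"
  unfolding inv_poly_scale_def by (rule M.L.add.finprod_one_eqI) (use assms in auto)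

lemma finite_coeff_support: "a \<in> carrier A \<Longrightarrow> finite {j. coeff a j \<noteq> \<zero>\<^bsub>R\<^esub>}"
  by (rule up_finite_support[OF coeff_up])

text \<open>Acting never raises the degree in x^-1: the coefficient at \<open>l\<close> of the
  result uses only coefficients of \<open>p\<close> at indices at least \<open>l\<close>.\<close>

lemma inv_poly_act_closed:
  assumes "p \<in> up M" "a \<in> carrier A"
  shows "p \<bullet>\<^bsub>Mx\<^esub> a \<in> up M"
proof -
  obtain n where n: "\<forall>k>n. p k = \<zero>\<^bsub>M\<^esub>" using assms by (auto simp: up_iff)
  have "(p \<bullet>\<^bsub>Mx\<^esub> a) l = \<zero>\<^bsub>M\<^esub>" if "l > n" for l
    unfolding Mx_simps
    by (rule M.L.add.finprod_one_eqI) (use assms n that in \<open>auto intro!: scale_eq_zero\<close>)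
  moreover have "(p \<bullet>\<^bsub>Mx\<^esub> a) l \<in> carrier M" for l
    unfolding Mx_simps using assms by (intro M.L.finsum_closed) (auto simp: scale_closed)
  ultimately show ?thesis by (intro upI'[of _ _ n]) auto
qed

lemma inv_poly_act_add:
  assumes "p \<in> up M" "q \<in> up M" "a \<in> carrier A"
  shows "(p \<oplus>\<^bsub>Mx\<^esub> q) \<bullet>\<^bsub>Mx\<^esub> a = p \<bullet>\<^bsub>Mx\<^esub> a \<oplus>\<^bsub>Mx\<^esub> q \<bullet>\<^bsub>Mx\<^esub> a"
  unfolding Mx_simps using assms
  by (intro ext, subst M.L.finsum_addf[symmetric])
    (auto intro!: M.L.finsum_cong' simp: scale_closed scale_add)

lemma up_uminus: "p \<in> up M \<Longrightarrow> (\<lambda>i. \<ominus>\<^bsub>M\<^esub> p i) \<in> up M"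
  by (rule up_mono[where p = p]) (auto simp: up_coeff_closed)

lemma abelian_group_Mx: "abelian_group Mx"
proof (rule abelian_groupI; unfold Mx_simps(1,2,3))
  fix p assume "p \<in> up M"
  then show "\<exists>q\<in>up M. (\<lambda>i. q i \<oplus>\<^bsub>M\<^esub> p i) = (\<lambda>i. \<zero>\<^bsub>M\<^esub>)"
    by (intro bexI[OF _ up_uminus]) (auto simp: up_coeff_closed M.L.l_neg)
next
  show "(\<lambda>i. \<zero>\<^bsub>M\<^esub>) \<in> up M" by (simp add: up_iff)
qed (auto simp: M.L.up_add up_coeff_closed M.L.a_ac)

sublocale Mx: right_action A Mx
  using abelian_group_Mx inv_poly_act_closed inv_poly_act_add
  by (simp add: right_action_def right_action_axioms_def Mx_simps(1))

lemma Mx_uminus: "p \<in> up M \<Longrightarrow> \<ominus>\<^bsub>Mx\<^esub> p = (\<lambda>i. \<ominus>\<^bsub>M\<^esub> p i)"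
  by (rule Mx.minus_equality) (auto simp: Mx_simps up_coeff_closed M.L.l_neg up_uminus)

lemma up_monomial: "m \<in> carrier M \<Longrightarrow> (\<lambda>i. if i = n then m else \<zero>\<^bsub>M\<^esub>) \<in> up M"
  by (rule upI'[of _ _ n]) auto

lemma scale_monomial:
  assumes "m \<in> carrier M" "r \<in> carrier R"
  shows "scale (\<lambda>i. if i = k then m else \<zero>\<^bsub>M\<^esub>) r i =
    (if i \<le> k then m \<bullet>\<^bsub>M\<^esub> word_sum k i r else \<zero>\<^bsub>M\<^esub>)"
proof -
  let ?S = "{k'. (if k' = k then m else \<zero>\<^bsub>M\<^esub>) \<noteq> \<zero>\<^bsub>M\<^esub> \<and> i \<le> k'}"
  show ?thesis
  \<comment> \<open>For \<open>m\<close> zero the sum over the support is empty even if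
    \<open>i \<le> k\<close>, so this case joins the vanishing one.\<close>
  proof (cases "m = \<zero>\<^bsub>M\<^esub> \<or> k < i")
    case True
    then have "?S = {}" by auto
    then have "scale (\<lambda>i. if i = k then m else \<zero>\<^bsub>M\<^esub>) r i = \<zero>\<^bsub>M\<^esub>"
      unfolding inv_poly_scale_def by (simp only: M.L.finsum_empty)
    then show ?thesis using True assms act.act_zero by auto
  next
    case False
    then have "?S = {k}" by auto
    then show ?thesis
      unfolding inv_poly_scale_def using assms False
      by (simp add: M.L.finsum_insert act.act_closed)
  qed
qed

end

section \<open>The submodule N[x^-1] and the annihilator of M/N\<close>

locale inverse_polynomials_sub = inverse_polynomials +
  fixes N
  assumes rsub_N: "rsubmodule R M N"
    and sigma_compat: "sigma_compatible R (rquotient M N) \<sigma>"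
    and delta_compat: "delta_compatible R (rquotient M N) \<delta>"
begin

sublocale N: right_action_sub R M N
  using rsub_N by unfold_locales

definition Nx where "Nx = {p \<in> up M. \<forall>i. p i \<in> N}"

definition annN where "annN = {r \<in> carrier R. \<forall>m\<in>carrier M. m \<bullet>\<^bsub>M\<^esub> r \<in> N}"

lemma annN_act: "\<lbrakk>r \<in> annN; m \<in> carrier M\<rbrakk> \<Longrightarrow> m \<bullet>\<^bsub>M\<^esub> r \<in> N"
  by (simp add: annN_def)

text \<open>Compatibility of M/N concerns one coset at a time; quantified over all cosets it becomes
  stability of the annihilator. The equivalence gives stability under the inverse of \<sigma> as
  well.\<close>

lemma annN_sigma: "r \<in> carrier R \<Longrightarrow> \<sigma> r \<in> annN \<longleftrightarrow> r \<in> annN"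
  using sigma_compat
  by (simp add: sigma_compatible_def annN_def N.rquotient_carrier N.rquotient_act N.rquotient_zero
      M.L.a_coset_eq_self_iff[OF N.add_sub] act.act_closed)

lemma annN_delta: "r \<in> annN \<Longrightarrow> \<delta> r \<in> annN"
  using delta_compat
  by (simp add: delta_compatible_def annN_def N.rquotient_carrier N.rquotient_act N.rquotient_zero
      M.L.a_coset_eq_self_iff[OF N.add_sub] act.act_closed)

text \<open>A termwise criterion with two uses: \<open>p\<close> with coefficients in
  \<open>N\<close>, and \<open>a\<close> with coefficients annihilating M/N.\<close>

lemma inv_poly_act_in_Nx:
  assumes "p \<in> up M" "a \<in> carrier A" "\<And>k i j. p k \<bullet>\<^bsub>M\<^esub> word_sum k i (coeff a j) \<in> N"
  shows "p \<bullet>\<^bsub>Mx\<^esub> a \<in> Nx"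
proof -
  have "scale p (coeff a j) i \<in> N" for i j
    unfolding inv_poly_scale_def using assms(3) by (intro M.L.finsum_in_subgroup[OF N.add_sub])
  then have "(p \<bullet>\<^bsub>Mx\<^esub> a) l \<in> N" for l
    unfolding Mx_simps by (intro M.L.finsum_in_subgroup[OF N.add_sub])
  then show ?thesis using assms inv_poly_act_closed by (simp add: Nx_def)
qed

lemma rsubmodule_Nx: "rsubmodule A Mx Nx"
proof -
  have "subgroup Nx (add_monoid Mx)"
  proof (rule Mx.add.subgroupI)
    show "Nx \<noteq> {}"
      using Mx.zero_closed N.N.zero_closed by (auto simp: Nx_def Mx_simps)
    show "\<ominus>\<^bsub>Mx\<^esub> p \<in> Nx" if "p \<in> Nx" for p
      using that by (auto simp: Nx_def Mx_uminus up_uminus)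
  qed (auto simp: Nx_def Mx_simps M.L.up_add)
  moreover have "p \<bullet>\<^bsub>Mx\<^esub> a \<in> Nx" if "p \<in> Nx" "a \<in> carrier A" for p a
    using that by (intro inv_poly_act_in_Nx) (auto simp: Nx_def intro: N.sub_act_closed)
  ultimately show ?thesis by (simp add: rsubmodule_def additive_subgroup_def)
qed

lemma Nx_proper: "N \<noteq> carrier M \<Longrightarrow> Nx \<noteq> up M"
proof -
  assume "N \<noteq> carrier M"
  then obtain m where m: "m \<in> carrier M" "m \<notin> N" using N.sub_carrier by blast
  then have "(\<lambda>i. if i = 0 then m else \<zero>\<^bsub>M\<^esub>) \<notin> Nx"
    by (auto simp: Nx_def intro!: exI[of _ 0])
  then show ?thesis using up_monomial[OF m(1)] by blast
qed

text \<open>These are leading coefficients modulo \<open>N\<close>: higher coefficients need only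
  lie in \<open>N\<close>, so that one computes modulo N[x^-1] without passing to cosets.\<close>

definition leading :: "_ set \<Rightarrow> nat \<Rightarrow> _ set"
  where "leading K n = {m. \<exists>p\<in>K. p n = m \<and> (\<forall>k>n. p k \<in> N)}"

text \<open>The coefficient at n collects contributions from indices k at least n. Those with k > n
  lie in \<open>N\<close> since \<open>p k\<close> does, and the one with k = n involves only the
  word \<sigma>'^n.\<close>

lemma scale_cong_leading:
  assumes "p \<in> up M" "r \<in> carrier R" "\<forall>k>n. p k \<in> N"
  shows "\<exists>v\<in>N. scale p r n = p n \<bullet>\<^bsub>M\<^esub> (sigma' R \<sigma> ^^ n) r \<oplus>\<^bsub>M\<^esub> v"
    and "n < l \<Longrightarrow> scale p r l \<in> N"
proof -
  let ?S = "{k. p k \<noteq> \<zero>\<^bsub>M\<^esub> \<and> n \<le> k}"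
  have "finite ?S" using up_finite_support[OF assms(1)] by (rule rev_finite_subset) auto
  then have "\<exists>v\<in>N. scale p r n = p n \<bullet>\<^bsub>M\<^esub> word_sum n n r \<oplus>\<^bsub>M\<^esub> v"
    unfolding inv_poly_scale_def using assms
    by (intro M.L.finsum_cong_subgroup[OF N.add_sub])
      (auto simp: scale_term_closed act.act_zero intro: N.sub_act_closed)
  then show "\<exists>v\<in>N. scale p r n = p n \<bullet>\<^bsub>M\<^esub> (sigma' R \<sigma> ^^ n) r \<oplus>\<^bsub>M\<^esub> v"
    using assms(2) by (simp add: word_sum_self)
  show "scale p r l \<in> N" if "n < l"
    unfolding inv_poly_scale_def using assms that
    by (intro M.L.finsum_in_subgroup[OF N.add_sub]) (auto intro: N.sub_act_closed)
qed

section \<open>Leading coefficients of a submodule above N[x^-1]\<close>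

context
  fixes K
  assumes K: "rsubmodule A Mx K" "Nx \<subseteq> K"
begin

lemma K_subgroup: "additive_subgroup K Mx"
  using K(1) by (simp add: rsubmodule_def)

lemma K_up: "p \<in> K \<Longrightarrow> p \<in> up M"
  using additive_subgroup.a_Hcarr[OF K_subgroup] by (simp add: Mx_simps(1))

lemma N_subset_leading: "N \<subseteq> leading K n"
proof
  fix m assume m: "m \<in> N"
  let ?p = "\<lambda>i. if i = n then m else \<zero>\<^bsub>M\<^esub>"
  have "?p \<in> Nx" using m up_monomial[OF N.sub_carrier[OF m]] by (auto simp: Nx_def)
  then have "?p \<in> K" using K(2) by blast
  then show "m \<in> leading K n" by (auto simp: leading_def intro!: bexI[of _ ?p])
qed

lemma leading_additive_subgroup: "additive_subgroup (leading K n) M"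
proof -
  have "subgroup (leading K n) (add_monoid M)"
  proof (rule M.L.add.subgroupI)
    show "leading K n \<subseteq> carrier M" using K_up up_coeff_closed by (auto simp: leading_def)
    show "leading K n \<noteq> {}" using N_subset_leading N.N.zero_closed by blast
  next
    fix m assume "m \<in> leading K n"
    then obtain p where p: "p \<in> K" "p n = m" "\<forall>k>n. p k \<in> N" by (auto simp: leading_def)
    have "\<ominus>\<^bsub>Mx\<^esub> p \<in> K" using p additive_subgroup.a_inv_closed[OF K_subgroup] by blast
    then have "(\<lambda>i. \<ominus>\<^bsub>M\<^esub> p i) \<in> K" using p K_up by (simp add: Mx_uminus)
    then show "\<ominus>\<^bsub>M\<^esub> m \<in> leading K n" using p by (auto simp: leading_def)
  next
    fix m m' assume "m \<in> leading K n" "m' \<in> leading K n"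
    then obtain p q where p: "p \<in> K" "p n = m" "\<forall>k>n. p k \<in> N"
      and q: "q \<in> K" "q n = m'" "\<forall>k>n. q k \<in> N" by (auto simp: leading_def)
    have "(\<lambda>i. p i \<oplus>\<^bsub>M\<^esub> q i) \<in> K"
      using p q additive_subgroup.a_closed[OF K_subgroup, of p q] by (simp add: Mx_simps)
    then show "m \<oplus>\<^bsub>M\<^esub> m' \<in> leading K n" using p q by (auto simp: leading_def)
  qed
  then show ?thesis by (simp add: additive_subgroup_def)
qed

lemma leading_rsubmodule: "rsubmodule R M (leading K n)"
proof -
  have "m \<bullet>\<^bsub>M\<^esub> r \<in> leading K n" if m: "m \<in> leading K n" and r: "r \<in> carrier R" for m r
  proof -
    obtain p where p: "p \<in> K" "p n = m" "\<forall>k>n. p k \<in> N" using m by (auto simp: leading_def)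
    have pu: "p \<in> up M" using p K_up by blast
    have mc: "m \<in> carrier M" using p pu up_coeff_closed by blast
    \<comment> \<open>Acting on \<open>p\<close> twists the leading coefficient by \<sigma>'^n;
      \<open>?s\<close> is chosen to cancel this twist, so that \<open>m\<close> is multiplied by
      \<open>r\<close> itself.\<close>
    let ?s = "(\<sigma> ^^ n) r"
    let ?q = "p \<bullet>\<^bsub>Mx\<^esub> \<iota> ?s"
    have s: "?s \<in> carrier R" using r by simp
    have q: "?q \<in> K" using K(1) p s by (simp add: rsubmodule_def)
    show ?thesis
    proof (cases "?s = \<zero>\<^bsub>R\<^esub>")
      case True
      \<comment> \<open>If \<open>?s\<close> is zero, its coefficient support is empty rather than
        \<open>{0}\<close>. Then \<open>r\<close> is zero as well, and the product is zero.\<close>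
      have "r = (sigma' R \<sigma> ^^ n) ((\<sigma> ^^ n) \<zero>\<^bsub>R\<^esub>)"
        using sigma'_pow_sigma_pow[OF r, of n] True by (simp add: sigma_pow_zero)
      then have "r = \<zero>\<^bsub>R\<^esub>" by (simp add: sigma'_pow_sigma_pow)
      moreover have "m \<bullet>\<^bsub>M\<^esub> \<zero>\<^bsub>R\<^esub> = \<zero>\<^bsub>M\<^esub>"
        using rsmult_r_distr[OF mc, of "\<zero>\<^bsub>R\<^esub>" "\<zero>\<^bsub>R\<^esub>"] act.act_closed[OF mc, of "\<zero>\<^bsub>R\<^esub>"] by simp
      ultimately show ?thesis
        using subsetD[OF N_subset_leading N.N.zero_closed] by simp
    next
      case False
      then have "{j. coeff (\<iota> ?s) j \<noteq> \<zero>\<^bsub>R\<^esub>} = {0}" using s by (auto simp: coeff_embed)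
      then have ql: "?q l = scale p ?s l" for l
        using s scale_closed[OF pu s] by (simp add: Mx_simps coeff_embed M.L.finsum_insert)
      obtain v where v: "v \<in> N" "?q n = m \<bullet>\<^bsub>M\<^esub> r \<oplus>\<^bsub>M\<^esub> v"
        using scale_cong_leading(1)[OF pu s p(3)] p(2) sigma'_pow_sigma_pow[OF r] ql by auto
      have "\<forall>k>n. ?q k \<in> N" using scale_cong_leading(2)[OF pu s p(3)] ql by simp
      then have "?q n \<in> leading K n" using q by (auto simp: leading_def)
      \<comment> \<open>The error \<open>v\<close> lies in \<open>N\<close>, hence in the leading
        submodule, and can be cancelled.\<close>
      then show ?thesis
        using M.L.additive_subgroup_add_cancel[OF leading_additive_subgroup, of "m \<bullet>\<^bsub>M\<^esub> r" v n]
          v N_subset_leading mc r act.act_closed by auto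
    qed
  qed
  then show ?thesis using leading_additive_subgroup by (simp add: rsubmodule_def)
qed

text \<open>Induction on the degree modulo \<open>N\<close>: some \<open>q\<close> in
  \<open>K\<close> has the same leading coefficient as \<open>p\<close>, and the difference has
  smaller degree modulo \<open>N\<close>. In degree zero nothing is left outside
  \<open>Nx\<close>.\<close>

lemma all_leading_imp_full:
  assumes "\<And>n. leading K n = carrier M" "p \<in> up M"
  shows "p \<in> K"
proof -
  obtain n where "\<forall>k>n. p k = \<zero>\<^bsub>M\<^esub>" using assms by (auto simp: up_iff)
  \<comment> \<open>Again a nonstrict bound, so that \<open>n = 0\<close> means that
    \<open>p\<close> lies in \<open>Nx\<close>.\<close>
  then have "\<exists>n. \<forall>k\<ge>n. p k \<in> N" by (intro exI[of _ "Suc n"]) simp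
  then obtain n where "\<forall>k\<ge>n. p k \<in> N" by blast
  then show ?thesis using assms(2)
  proof (induction n arbitrary: p)
    case 0
    then have "p \<in> Nx" by (simp add: Nx_def)
    then show ?case using K(2) by blast
  next
    case (Suc d)
    obtain q where q: "q \<in> K" "q d = p d" "\<forall>k>d. q k \<in> N"
      using assms(1)[of d] up_coeff_closed[OF Suc.prems(2), of d] by (auto simp: leading_def)
    have qu: "q \<in> up M" using q K_up by blast
    let ?q = "\<lambda>i. p i \<oplus>\<^bsub>M\<^esub> \<ominus>\<^bsub>M\<^esub> q i"
    have q': "?q \<in> up M" using Suc.prems qu by (intro M.L.up_add up_uminus)
    have N': "\<forall>k\<ge>d. ?q k \<in> N"
    proof (intro allI impI)
      fix k assume "d \<le> k"
      then consider "k = d" | "k > d" by linarith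
      then show "?q k \<in> N"
      proof cases
        case 1
        then show ?thesis using q(2) up_coeff_closed[OF Suc.prems(2)] by (simp add: M.L.r_neg)
      next
        case 2
        then show ?thesis using q(3) Suc.prems(1) by simp
      qed
    qed
    have "?q \<in> K" using N' q' by (rule Suc.IH)
    then have "?q \<oplus>\<^bsub>Mx\<^esub> q \<in> K" using q(1) by (rule additive_subgroup.a_closed[OF K_subgroup])
    moreover have "?q \<oplus>\<^bsub>Mx\<^esub> q = p"
      unfolding Mx_simps using up_coeff_closed[OF Suc.prems(2)] up_coeff_closed[OF qu]
      by (simp add: M.L.a_assoc M.L.l_neg)
    ultimately show ?case by simp
  qed
qed

end

text \<open>The right-hand side is independent of \<open>K\<close>, so the cases
  \<open>K = Nx\<close> and \<open>K\<close> arbitrary together give both coprimality and the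
  annihilator. The hypothesis \<open>coprime\<close> is coprimality of M/N in the form of
  \<open>coprime_rquotient_iff\<close>.\<close>

lemma annihilator_quotient:
  assumes K: "rsubmodule A Mx K" "Nx \<subseteq> K" "K \<noteq> up M"
    and "skew_ore_stable_ideal R A \<sigma> \<delta> \<iota> x annN"
    and coprime: "\<And>L. \<lbrakk>rsubmodule R M L; N \<subseteq> L; L \<noteq> carrier M\<rbrakk>
      \<Longrightarrow> {r \<in> carrier R. \<forall>m\<in>carrier M. m \<bullet>\<^bsub>M\<^esub> r \<in> L} = annN"
  shows "{a \<in> carrier A. \<forall>p\<in>up M. p \<bullet>\<^bsub>Mx\<^esub> a \<in> K} = {a \<in> carrier A. \<forall>j. coeff a j \<in> annN}"
proof (intro equalityI subsetI)
  interpret I: skew_ore_stable_ideal R A \<sigma> \<delta> \<iota> x annN by fact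
  {
    fix a assume "a \<in> {a \<in> carrier A. \<forall>j. coeff a j \<in> annN}"
    then have a: "a \<in> carrier A" "\<And>j. coeff a j \<in> annN" by auto
    have "p \<bullet>\<^bsub>Mx\<^esub> a \<in> Nx" if "p \<in> up M" for p
    proof (rule inv_poly_act_in_Nx[OF that a(1)])
      fix k i j
      have "word_sum k i (coeff a j) \<in> annN" using a(2) by (rule I.word_sum_stable)
      then show "p k \<bullet>\<^bsub>M\<^esub> word_sum k i (coeff a j) \<in> N"
        using up_coeff_closed[OF that] by (rule annN_act)
    qed
    then show "a \<in> {a \<in> carrier A. \<forall>p\<in>up M. p \<bullet>\<^bsub>Mx\<^esub> a \<in> K}" using a(1) K(2) by blast
  next
    fix a assume "a \<in> {a \<in> carrier A. \<forall>p\<in>up M. p \<bullet>\<^bsub>Mx\<^esub> a \<in> K}"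
    then have a: "a \<in> carrier A" "\<And>p. p \<in> up M \<Longrightarrow> p \<bullet>\<^bsub>Mx\<^esub> a \<in> K" by auto
    \<comment> \<open>Since \<open>K\<close> is proper, some leading submodule is proper; this fixes
      the degree \<open>n\<close> used for all coefficients of \<open>a\<close>.\<close>
    have "up M \<noteq> K \<and> K \<subseteq> up M" using K K_up by blast
    then obtain n where n: "leading K n \<noteq> carrier M"
      using all_leading_imp_full[OF K(1,2)] by blast
    note L = leading_rsubmodule[OF K(1,2), of n] N_subset_leading[OF K(1,2), of n]
    have "coeff a j \<in> annN" for j
    proof (induction j rule: less_induct)
      case (less j)
      show ?case
      proof (cases "coeff a j = \<zero>\<^bsub>R\<^esub>")
        case False
        have "m \<bullet>\<^bsub>M\<^esub> (sigma' R \<sigma> ^^ (n + j)) (coeff a j) \<in> leading K n" if m: "m \<in> carrier M" for m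
        proof -
          \<comment> \<open>The exponent n + j is chosen so that the term of \<open>a\<close> at x^j
            moves the leading term of the monomial to place n.\<close>
          let ?p = "\<lambda>i. if i = n + j then m else \<zero>\<^bsub>M\<^esub>"
          let ?q = "?p \<bullet>\<^bsub>Mx\<^esub> a"
          have p: "?p \<in> up M" using m by (rule up_monomial)
          have g: "scale ?p (coeff a i) (l + i) =
              (if l + i \<le> n + j then m \<bullet>\<^bsub>M\<^esub> word_sum (n + j) (l + i) (coeff a i) else \<zero>\<^bsub>M\<^esub>)" for l i
            using m a(1) by (simp add: scale_monomial)
          \<comment> \<open>Terms with \<open>i < j\<close> lie in \<open>N\<close> by the induction
            hypothesis and stability under words. For the others the index \<open>l + i\<close>
            exceeds the degree n + j of the monomial, so they vanish.\<close>
          have gN: "scale ?p (coeff a i) (l + i) \<in> N" if "n \<le> l" "i \<noteq> j \<or> n < l" for l i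
          proof (cases "i < j")
            case True
            then have "word_sum (n + j) (l + i) (coeff a i) \<in> annN"
              using less by (intro I.word_sum_stable)
            then show ?thesis using m unfolding g by (simp add: annN_act)
          next
            case False
            then have "\<not> l + i \<le> n + j" using that by linarith
          then show ?thesis unfolding g by simp
          qed
          have above: "\<forall>l>n. ?q l \<in> N"
            unfolding Mx_simps using gN by (auto intro!: M.L.finsum_in_subgroup[OF N.add_sub])
          have "\<exists>v\<in>N. ?q n = scale ?p (coeff a j) (n + j) \<oplus>\<^bsub>M\<^esub> v"
            unfolding Mx_simps
          proof (rule M.L.finsum_cong_subgroup[OF N.add_sub finite_coeff_support[OF a(1)]])
            show "scale ?p (coeff a i) (n + i) \<in> carrier M" for i
              using p a(1) by (simp add: scale_closed)
            show "scale ?p (coeff a i) (n + i) \<in> N" if "i \<noteq> j" for i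
              using gN that by simp
          \<comment> \<open>The coefficient at j is nonzero, so j belongs to the support summed
            over.\<close>
          qed (use False in auto)
          then obtain v where v: "v \<in> N"
            "?q n = m \<bullet>\<^bsub>M\<^esub> (sigma' R \<sigma> ^^ (n + j)) (coeff a j) \<oplus>\<^bsub>M\<^esub> v"
            using g[of j n] a(1) by (auto simp: word_sum_self)
          have "?q n \<in> leading K n" using a(2)[OF p] above by (auto simp: leading_def)
          then show ?thesis
            using M.L.additive_subgroup_add_cancel[OF leading_additive_subgroup[OF K(1,2)],
                of "m \<bullet>\<^bsub>M\<^esub> (sigma' R \<sigma> ^^ (n + j)) (coeff a j)" v n]
              v L(2) m a(1) act.act_closed by auto
        qed
        \<comment> \<open>The proper leading submodule contains \<open>N\<close>, so by coprimality
          its quotient has annihilator \<open>annN\<close>; stability under \<sigma> then removes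
          the twist.\<close>
        then have "(sigma' R \<sigma> ^^ (n + j)) (coeff a j) \<in> annN"
          using coprime[OF L n] a(1) by auto
        then have "(\<sigma> ^^ (n + j)) ((sigma' R \<sigma> ^^ (n + j)) (coeff a j)) \<in> annN"
          using a(1) I.sigma_pow_stable by simp
        then show ?thesis using a(1) sigma_pow_sigma'_pow by simp
      qed simp
    qed
    then show "a \<in> {a \<in> carrier A. \<forall>j. coeff a j \<in> annN}" using a(1) by blast
  }
qed

end

section \<open>Coprimality of M[x^-1]/N[x^-1] and its annihilator PA\<close>

theorem theorem3p8:
  fixes R :: "('r, 'b) ring_scheme" and A :: "('a, 'c) ring_scheme"
    and M :: "('r, 'm, 'd) rmodule_scheme"
    and \<sigma> \<delta> :: "'r \<Rightarrow> 'r" and \<iota> :: "'r \<Rightarrow> 'a" and x :: 'a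
  assumes "ring R"
    and "\<sigma> \<in> ring_iso R R"
    and "skew_derivation R \<sigma> \<delta>"
    and "locally_nilpotent R \<delta>"
    and "skew_ore_ring R A \<sigma> \<delta> \<iota> x"
    and "right_module R M"
    and "completely_compatible R M \<sigma> \<delta>"
  shows "Att A (inv_poly_module R A \<sigma> \<delta> \<iota> x M) \<supseteq>
    {right_ideal_generated A (\<iota> ` P) |P. P \<in> Att R M}"
proof
  fix PA assume "PA \<in> {right_ideal_generated A (\<iota> ` P) |P. P \<in> Att R M}"
  then obtain P N where PA: "PA = right_ideal_generated A (\<iota> ` P)"
    and prime: "nc_prime_ideal R P" and N: "rsubmodule R M N"
    and coprime: "coprime_module R (rquotient M N)" and P: "P = rannihilator R (rquotient M N)"
    by (auto simp: Att_def)
  \<comment> \<open>Complete compatibility is evaluated at the submodule \<open>N\<close> whose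
    quotient attaches \<open>P\<close>.\<close>
  have "sigma_compatible R (rquotient M N) \<sigma>" "delta_compatible R (rquotient M N) \<delta>"
    using assms(7) N by (simp_all add: completely_compatible_def
        completely_sigma_compatible_def completely_delta_compatible_def)
  with assms N interpret inverse_polynomials_sub R A \<sigma> \<delta> \<iota> x M N
    by (simp add: inverse_polynomials_sub_def inverse_polynomials_sub_axioms_def
        inverse_polynomials_def skew_ore_poly_ring_def skew_ore_poly_ring_axioms_def)
  have annN: "annN = P" by (simp add: P annN_def N.rannihilator_rquotient)
  have stable: "skew_ore_stable_ideal R A \<sigma> \<delta> \<iota> x annN"
    using prime annN skew_ore_poly_ring_axioms annN_sigma annN_delta
    by (intro skew_ore_stable_idealI) (auto simp: nc_prime_ideal_def)
  have PA_eq: "PA = {a \<in> carrier A. \<forall>j. coeff a j \<in> annN}"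
    using skew_ore_stable_ideal.right_ideal_generated_eq_extension[OF stable]
    by (simp add: PA annN skew_ore_stable_ideal.extension_def[OF stable[unfolded annN]])
  have PA_prime: "nc_prime_ideal A PA"
    using skew_ore_stable_ideal.extension_prime[OF stable] prime
    by (simp add: PA_eq annN skew_ore_stable_ideal.extension_def[OF stable[unfolded annN]])
  have N_ne: "N \<noteq> carrier M"
    using coprime by (simp add: N.coprime_rquotient_iff)
  have L: "{r \<in> carrier R. \<forall>m\<in>carrier M. m \<bullet>\<^bsub>M\<^esub> r \<in> L} = annN"
    if "rsubmodule R M L" "N \<subseteq> L" "L \<noteq> carrier M" for L
    using coprime that by (simp add: N.coprime_rquotient_iff annN_def)
  interpret Nx: right_action_sub A Mx Nx
    using rsubmodule_Nx by unfold_locales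
  have ann: "{a \<in> carrier A. \<forall>p\<in>up M. p \<bullet>\<^bsub>Mx\<^esub> a \<in> K} = PA"
    if "rsubmodule A Mx K" "Nx \<subseteq> K" "K \<noteq> up M" for K
    unfolding PA_eq using that stable L by (rule annihilator_quotient)
  \<comment> \<open>In the criterion both annihilators equal \<open>PA\<close>: one is
    \<open>ann\<close> at \<open>Nx\<close> itself, the other \<open>ann\<close> at
    \<open>K\<close>.\<close>
  have "coprime_module A (rquotient Mx Nx)"
    unfolding Nx.coprime_rquotient_iff Mx_simps(1)
    using ann[OF rsubmodule_Nx order_refl Nx_proper[OF N_ne]] Nx_proper[OF N_ne] ann by simp
  moreover have "PA = rannihilator A (rquotient Mx Nx)"
    unfolding Nx.rannihilator_rquotient Mx_simps(1)
    using ann[OF rsubmodule_Nx order_refl Nx_proper[OF N_ne]] by simp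
  ultimately show "PA \<in> Att A Mx"
    using PA_prime rsubmodule_Nx by (auto simp: Att_def)
qed

end
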